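(* The category $\mathcal{C}(nupOp)^{op}$ described in the context is quasi-Gröbner.
   Context: Quasi-Gröbner categories. Let $\mathcal{C}$ be a small category and $c$ an object. An admissible order on the morphisms out of $c$ is a choice, for every object $c'$, of a well-order $\preceq_{c'}$ on $\mathrm{Hom}(c,c')$ such that for all $f,f':c\to c'$ and $g:c'\to c''$, $f\prec_{c'} f'$ implies $g\circ f\prec_{c''} g\circ f'$. On the set of morphisms out of $c$ put the preorder $f\le g$ iff $g=h\circ f$ for some $h$; $|c/\mathcal{C}|$ is the associated poset. A poset is Noetherian if every sequence $x_1,x_2,\dots$ has $i<j$ with $x_i\le x_j$. $\mathcal{C}$ is Gröbner if for every object $c$: (G1) the morphisms out of $c$ admit an admissible order, and (G2) $|c/\mathcal{C}|$ is Noetherian. A functor $\Phi:\mathcal{C}\to\mathcal{D}$ has property (F) if for every object $d$ of $\mathcal{D}$ there are finitely many objects $c_1,\dots,c_n$ of $\mathcal{C}$ and morphisms $f_i:d\to\Phi(c_i)$ such that every morphism $f:d\to\Phi(c)$ factors as $\Phi(g)\circ f_i$ for some $i$ and some $g:c_i\to c$. A category $\mathcal{D}$ is quasi-Gröbner if there is a Gröbner category $\mathcal{C}$ and an essentially surjective functor $\mathcal{C}\to\mathcal{D}$ with property (F). Operadic graphs. A graph with half-edges is a finite set $V$ of vertices, a finite set $H$ of half-edges, an involution $inv$ on $H$ and a map $t:H\to V$; fixed points of $inv$ are leaves, two-element orbits are edges. An operadic graph is such a graph together with a total order on the leaves (indexed $0,1,\dots$), for each vertex $v$ a total order on $t^{-1}(v)$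 (indexed $0,1,\dots$), and a total order on $V$ (indexed $1,\dots,n$). Operadic graphs are considered up to isomorphism preserving all this data. An operadic tree is an operadic graph whose underlying graph is a tree, having at least one leaf, such that at every vertex the $0$-th half-edge is the one on the path towards the $0$-th leaf (the root); it is planar if the order on its non-root leaves is the planar order induced by the orders of half-edges at the vertices. The arity of a vertex is its number of non-$0$-th half-edges (vertices of arity $0$ are allowed). The category $\mathcal{C}(nupOp)^{op}$: objects are planar operadic trees with at least one vertex. If $p$ has vertices $v_1<\dots<v_n$, a morphism $f:p\to q$ consists of planar operadic trees $q_1,\dots,q_n$ (each with at least one vertex), where $q_l$ has exactly as many leaves as $v_l$ has half-edges, together with a bijection from $\bigsqcup_l V(q_l)$ to the vertex set of $q$ that is order preserving on each $V(q_l)$, such that $q$ is the graph obtained by substitution: take the disjoint union of the $q_l$, identify the $i$-th leaf of $q_l$ with the $i$-th half-edge of $v_l$; if the $i$-th half-edge of $v_j$ and the $k$-th half-edge of $v_l$ form an edge of $p$, then the $i$-th leaf of $q_j$ and the $k$-th leaf of $q_l$ form an edge of $q$; if the $i$-th half-edge of $v_j$ is the $k$-th leaf of $p$, then the $i$-th leaf of $q_j$ is the $k$-th leaf of $q$; half-edge orders at vertices come from the $q_l$, and the vertex order of $q$ is transported along the bijection. Composition is iterated substitution. (This is the opposite of the category $\mathcal{C}(P)$ of de Brito et al.\ for the operad $P$ of planar operads, restricted to operations of non-zero arity.) *)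

theory Defs
  imports Main
begin

record ('o, 'm) category =
  Ob  :: "'o set"
  Hom :: "'o \<Rightarrow> 'o \<Rightarrow> 'm set"
  Cmp :: "'m \<Rightarrow> 'm \<Rightarrow> 'm"   (* Cmp C g f = g \<circ> f *)
  Idm :: "'o \<Rightarrow> 'm"

definition is_category :: "('o, 'm) category \<Rightarrow> bool" where
  "is_category C \<longleftrightarrow>
     (\<forall>a b a' b'. a \<in> Ob C \<and> b \<in> Ob C \<and> a' \<in> Ob C \<and> b' \<in> Ob C \<and> (a, b) \<noteq> (a', b')
        \<longrightarrow> Hom C a b \<inter> Hom C a' b' = {}) \<and>
     (\<forall>a. a \<in> Ob C \<longrightarrow> Idm C a \<in> Hom C a a) \<and>
     (\<forall>a b c f g. a \<in> Ob C \<and> b \<in> Ob C \<and> c \<in> Ob C \<and> f \<in> Hom C a b \<and> g \<in> Hom C b c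
        \<longrightarrow> Cmp C g f \<in> Hom C a c) \<and>
     (\<forall>a b c d f g h. a \<in> Ob C \<and> b \<in> Ob C \<and> c \<in> Ob C \<and> d \<in> Ob C \<and>
        f \<in> Hom C a b \<and> g \<in> Hom C b c \<and> h \<in> Hom C c d
        \<longrightarrow> Cmp C h (Cmp C g f) = Cmp C (Cmp C h g) f) \<and>
     (\<forall>a b f. a \<in> Ob C \<and> b \<in> Ob C \<and> f \<in> Hom C a b
        \<longrightarrow> Cmp C (Idm C b) f = f \<and> Cmp C f (Idm C a) = f)"

definition out_mor :: "('o, 'm) category \<Rightarrow> 'o \<Rightarrow> 'm set" where
  "out_mor C c = (\<Union>c'\<in>Ob C. Hom C c c')"

definition admissible_order :: "('o, 'm) category \<Rightarrow> 'o \<Rightarrow> ('o \<Rightarrow> 'm rel) \<Rightarrow> bool" where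
  "admissible_order C c R \<longleftrightarrow>
     (\<forall>c'\<in>Ob C. well_order_on (Hom C c c') (R c')) \<and>
     (\<forall>c'\<in>Ob C. \<forall>c''\<in>Ob C. \<forall>f f' g.
        f \<in> Hom C c c' \<and> f' \<in> Hom C c c' \<and> g \<in> Hom C c' c'' \<and>
        (f, f') \<in> R c' \<and> f \<noteq> f'
        \<longrightarrow> (Cmp C g f, Cmp C g f') \<in> R c'' \<and> Cmp C g f \<noteq> Cmp C g f')"

definition factor_le :: "('o, 'm) category \<Rightarrow> 'o \<Rightarrow> 'm \<Rightarrow> 'm \<Rightarrow> bool" where
  "factor_le C c f g \<longleftrightarrow>
     (\<exists>c'\<in>Ob C. \<exists>c''\<in>Ob C. \<exists>h. f \<in> Hom C c c' \<and> g \<in> Hom C c c'' \<and>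
        h \<in> Hom C c' c'' \<and> g = Cmp C h f)"

text \<open>Noetherianity of the poset |c/C| (stated on representatives: the
  associated poset is the quotient of the preorder factor_le).\<close>
definition noetherian_under :: "('o, 'm) category \<Rightarrow> 'o \<Rightarrow> bool" where
  "noetherian_under C c \<longleftrightarrow>
     (\<forall>x :: nat \<Rightarrow> 'm. (\<forall>i. x i \<in> out_mor C c) \<longrightarrow>
        (\<exists>i j. i < j \<and> factor_le C c (x i) (x j)))"

definition groebner :: "('o, 'm) category \<Rightarrow> bool" where
  "groebner C \<longleftrightarrow> is_category C \<and>
     (\<forall>c\<in>Ob C. (\<exists>R. admissible_order C c R) \<and> noetherian_under C c)"

definition is_functor ::
  "('o, 'm) category \<Rightarrow> ('p, 'n) category \<Rightarrow> ('o \<Rightarrow> 'p) \<Rightarrow> ('m \<Rightarrow> 'n) \<Rightarrow> bool" where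
  "is_functor C D Fo Fm \<longleftrightarrow> is_category C \<and> is_category D \<and>
     (\<forall>a\<in>Ob C. Fo a \<in> Ob D) \<and>
     (\<forall>a\<in>Ob C. \<forall>b\<in>Ob C. \<forall>f\<in>Hom C a b. Fm f \<in> Hom D (Fo a) (Fo b)) \<and>
     (\<forall>a\<in>Ob C. Fm (Idm C a) = Idm D (Fo a)) \<and>
     (\<forall>a\<in>Ob C. \<forall>b\<in>Ob C. \<forall>c\<in>Ob C. \<forall>f\<in>Hom C a b. \<forall>g\<in>Hom C b c.
        Fm (Cmp C g f) = Cmp D (Fm g) (Fm f))"

definition essentially_surjective ::
  "('o, 'm) category \<Rightarrow> ('p, 'n) category \<Rightarrow> ('o \<Rightarrow> 'p) \<Rightarrow> bool" where
  "essentially_surjective C D Fo \<longleftrightarrow>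
     (\<forall>d\<in>Ob D. \<exists>c\<in>Ob C. \<exists>u v. u \<in> Hom D (Fo c) d \<and> v \<in> Hom D d (Fo c) \<and>
        Cmp D v u = Idm D (Fo c) \<and> Cmp D u v = Idm D d)"

definition property_F ::
  "('o, 'm) category \<Rightarrow> ('p, 'n) category \<Rightarrow> ('o \<Rightarrow> 'p) \<Rightarrow> ('m \<Rightarrow> 'n) \<Rightarrow> bool" where
  "property_F C D Fo Fm \<longleftrightarrow>
     (\<forall>d\<in>Ob D. \<exists>S :: ('o \<times> 'n) set. finite S \<and>
        (\<forall>(ci, fi)\<in>S. ci \<in> Ob C \<and> fi \<in> Hom D d (Fo ci)) \<and>
        (\<forall>c\<in>Ob C. \<forall>f\<in>Hom D d (Fo c). \<exists>(ci, fi)\<in>S. \<exists>g\<in>Hom C ci c. f = Cmp D (Fm g) fi))"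

text \<open>Quasi-Groebner. The witnessing Groebner category is taken with objects and
  morphisms encoded in nat (all categories in question are countable).\<close>
definition quasi_groebner :: "('p, 'n) category \<Rightarrow> bool" where
  "quasi_groebner D \<longleftrightarrow>
     (\<exists>(C :: (nat, nat) category) Fo Fm. groebner C \<and> is_functor C D Fo Fm \<and>
        essentially_surjective C D Fo \<and> property_F C D Fo Fm)"

text \<open>A planar operadic tree with at least one vertex is represented canonically:
  Node l cs is a vertex with label l (its position in the vertex order) whose
  half-edges 1..length cs (in order) lead to the subtrees cs; half-edge 0 points
  to the root. Leaf is a (non-root) leaf. The order on leaves is the planar one;
  since all data is ordered, isomorphism classes correspond exactly to such terms
  whose labels are a permutation of 1..n.\<close>
datatype ptree = Leaf | Node nat "ptree list"

fun labels :: "ptree \<Rightarrow> nat list" where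
  "labels Leaf = []"
| "labels (Node l cs) = l # concat (map labels cs)"

fun nleaves :: "ptree \<Rightarrow> nat" \<comment> \<open>number of non-root leaves\<close> where
  "nleaves Leaf = 1"
| "nleaves (Node l cs) = sum_list (map nleaves cs)"

fun vertex_arities :: "ptree \<Rightarrow> (nat \<times> nat) list" where
  "vertex_arities Leaf = []"
| "vertex_arities (Node l cs) = (l, length cs) # concat (map vertex_arities cs)"

definition arity :: "ptree \<Rightarrow> nat \<Rightarrow> nat" where
  "arity t l = the (map_of (vertex_arities t) l)"

definition nverts :: "ptree \<Rightarrow> nat" where
  "nverts t = length (labels t)"

definition is_ptree :: "ptree \<Rightarrow> bool" where
  "is_ptree t \<longleftrightarrow> t \<noteq> Leaf \<and> distinct (labels t) \<and> set (labels t) = {1..nverts t}"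

fun relabel :: "(nat \<Rightarrow> nat) \<Rightarrow> ptree \<Rightarrow> ptree" where
  "relabel f Leaf = Leaf"
| "relabel f (Node l cs) = Node (f l) (map (relabel f) cs)"

fun graft :: "ptree \<Rightarrow> ptree list \<Rightarrow> ptree \<times> ptree list"
and graft_list :: "ptree list \<Rightarrow> ptree list \<Rightarrow> ptree list \<times> ptree list" where
  "graft Leaf as = (case as of [] \<Rightarrow> (Leaf, []) | a # r \<Rightarrow> (a, r))"
| "graft (Node l cs) as = (let (cs', r) = graft_list cs as in (Node l cs', r))"
| "graft_list [] as = ([], as)"
| "graft_list (c # cs) as =
     (let (c', r) = graft c as; (cs', r') = graft_list cs r in (c' # cs', r'))"

fun subst :: "ptree \<Rightarrow> (nat \<Rightarrow> ptree) \<Rightarrow> ptree" where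
  "subst Leaf F = Leaf"
| "subst (Node l cs) F = fst (graft (F l) (map (\<lambda>c. subst c F) cs))"

text \<open>A morphism p \<rightarrow> q: the trees q_1..q_n (list, q_l at index l-1) and the
  bijection \<Union> V(q_l) \<rightarrow> V(q) given blockwise (list of lists: the vertex j of
  q_l goes to vertex  shuf!(l-1)!(j-1)  of q).\<close>
record nmor =
  msrc   :: ptree
  mtrees :: "ptree list"
  mshuf  :: "nat list list"
  mtgt   :: ptree

definition subst_family :: "ptree list \<Rightarrow> nat list list \<Rightarrow> nat \<Rightarrow> ptree" where
  "subst_family ts ss l = relabel (\<lambda>j. ss ! (l - 1) ! (j - 1)) (ts ! (l - 1))"

definition is_nmor :: "ptree \<Rightarrow> ptree \<Rightarrow> nmor \<Rightarrow> bool" where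
  "is_nmor p q m \<longleftrightarrow>
     msrc m = p \<and> mtgt m = q \<and> is_ptree p \<and> is_ptree q \<and>
     length (mtrees m) = nverts p \<and> length (mshuf m) = nverts p \<and>
     (\<forall>l\<in>{1..nverts p}.
        is_ptree (mtrees m ! (l - 1)) \<and>
        nleaves (mtrees m ! (l - 1)) = arity p l \<and>
        length (mshuf m ! (l - 1)) = nverts (mtrees m ! (l - 1)) \<and>
        sorted_wrt (<) (mshuf m ! (l - 1))) \<and>
     distinct (concat (mshuf m)) \<and> set (concat (mshuf m)) = {1..nverts q} \<and>
     q = subst p (subst_family (mtrees m) (mshuf m))"

definition corolla :: "nat \<Rightarrow> ptree" where
  "corolla k = Node 1 (replicate k Leaf)"

definition nid :: "ptree \<Rightarrow> nmor" where
  "nid p = \<lparr> msrc = p, mtrees = map (\<lambda>l. corolla (arity p l)) [1..<nverts p + 1],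
             mshuf = map (\<lambda>l. [l]) [1..<nverts p + 1], mtgt = p \<rparr>"

text \<open>Composition g \<circ> f by iterated substitution: the l-th tree of the composite
  is q_l with each of its vertices replaced by the corresponding tree of g,
  with vertex order induced from the final target.\<close>
definition ncomp :: "nmor \<Rightarrow> nmor \<Rightarrow> nmor" where
  "ncomp g f =
    (let T = (\<lambda>l. subst (mtrees f ! (l - 1))
                     (\<lambda>j. subst_family (mtrees g) (mshuf g) (mshuf f ! (l - 1) ! (j - 1))));
         S = (\<lambda>l. sort (labels (T l)));
         n = length (mtrees f)
     in \<lparr> msrc = msrc f,
          mtrees = map (\<lambda>l. relabel (\<lambda>x. length (filter (\<lambda>y. y < x) (S l)) + 1) (T l)) [1..<n + 1],
          mshuf = map S [1..<n + 1],
          mtgt = mtgt g \<rparr>)"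

definition nupOp_op :: "(ptree, nmor) category" where
  "nupOp_op = \<lparr> Ob = {t. is_ptree t}, Hom = (\<lambda>p q. {m. is_nmor p q m}),
                Cmp = ncomp, Idm = nid \<rparr>"

end

theory Submission
  imports Defs "HOL-Library.Multiset" "HOL-Library.Ramsey" "HOL-Library.Countable"
begin

text \<open>
  The category itself is already Groebner; only its objects and morphisms have to be encoded in the
  natural numbers.

  A morphism \<open>p \<rightarrow> q\<close> is the same as a family of trees with pairwise disjoint label sets, indexed
  by the vertices of \<open>p\<close>, whose substitution into \<open>p\<close> is \<open>q\<close>. It is determined by the
  induced map from the vertices of \<open>q\<close> to those of \<open>p\<close>, hence by the word listing the values
  of this map along the preorder of \<open>q\<close>. The first occurrences in such a word list the vertices of
  \<open>p\<close> in preorder, because the root of each block precedes the blocks above it. Therefore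
  postcomposition respects the lexicographic order of words, which is the admissible order.

  For Noetherianity, \<open>g\<close> factors through \<open>f\<close> as soon as every tree of \<open>f\<close> is an
  edge contraction of the corresponding tree of \<open>g\<close>. Among ordered trees with a given number of
  leaves, a tree is a contraction of any tree it embeds into, so Kruskal's tree theorem applies.
\<close>

section \<open>Grafting and substitution\<close>

text \<open>Treats the nested datatype as a mutual one, so that a claim on trees and its companion
  on forests need only one induction.\<close>

lemma ptree_forest_induct [case_names Leaf Node Nil Cons]:
  assumes "P Leaf" "\<And>l cs. Q cs \<Longrightarrow> P (Node l cs)" "Q []"
    "\<And>c cs. P c \<Longrightarrow> Q cs \<Longrightarrow> Q (c # cs)"
  shows "P t" and "Q cs"
proof -
  have *: "P t" for t
  proof (induction t)
    case (Node l cs)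
    then have "Q cs" by (induction cs) (auto intro: assms)
    then show ?case by (rule assms)
  qed (rule assms)
  then show "P t" .
  show "Q cs" by (induction cs) (auto intro: assms *)
qed

text \<open>Relational form of \<open>graft\<close>: the list of grafted trees is used up exactly
  and split by concatenation, instead of being threaded through as a remainder. Later facts then
  follow by rule induction.\<close>

inductive grafts :: "ptree \<Rightarrow> ptree list \<Rightarrow> ptree \<Rightarrow> bool"
  and graftsl :: "ptree list \<Rightarrow> ptree list \<Rightarrow> ptree list \<Rightarrow> bool" where
  Leaf: "grafts Leaf [a] a"
| Node: "graftsl cs as ss \<Longrightarrow> grafts (Node l cs) as (Node l ss)"
| Nil: "graftsl [] [] []"
| Cons: "grafts c as s \<Longrightarrow> graftsl cs bs ss \<Longrightarrow> graftsl (c # cs) (as @ bs) (s # ss)"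

inductive_cases grafts_LeafE: "grafts Leaf as s"
inductive_cases grafts_NodeE: "grafts (Node l cs) as s"
inductive_cases graftsl_NilE: "graftsl [] as s"
inductive_cases graftsl_ConsE: "graftsl (c # cs) as s"

text \<open>The remainder \<open>r\<close> is arbitrary because each tree of a forest passes on to
  its right siblings whatever it has not consumed.\<close>

lemma graft_if_grafts:
  "grafts T as s \<Longrightarrow> graft T (as @ r) = (s, r)"
  "graftsl cs as ss \<Longrightarrow> graft_list cs (as @ r) = (ss, r)"
  by (induction arbitrary: r and r rule: grafts_graftsl.inducts) auto

lemma fst_graft_if_grafts: "grafts T as s \<Longrightarrow> fst (graft T as) = s"
  using graft_if_grafts(1)[of T as s "[]"] by simp

lemma grafts_determ: "grafts T as s \<Longrightarrow> grafts T as s' \<Longrightarrow> s = s'"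
  using fst_graft_if_grafts by blast

lemma length_grafts:
  "grafts T as s \<Longrightarrow> length as = nleaves T"
  "graftsl cs as ss \<Longrightarrow> length as = sum_list (map nleaves cs) \<and> length ss = length cs"
  by (induction rule: grafts_graftsl.inducts) auto

lemma grafts_exists:
  "length as = nleaves T \<Longrightarrow> \<exists>s. grafts T as s"
  "length as = sum_list (map nleaves cs) \<Longrightarrow> \<exists>ss. graftsl cs as ss"
proof (induction T and cs arbitrary: as and as rule: ptree_forest_induct)
  case Leaf
  then show ?case by (cases as) (auto intro: grafts_graftsl.intros)
next
  case (Cons c cs)
  have "length (take (nleaves c) as) = nleaves c"
    "length (drop (nleaves c) as) = sum_list (map nleaves cs)"
    using Cons.prems by auto
  then obtain s ss where "grafts c (take (nleaves c) as) s" "graftsl cs (drop (nleaves c) as) ss"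
    using Cons.IH by metis
  then have "graftsl (c # cs) (take (nleaves c) as @ drop (nleaves c) as) (s # ss)"
    by (rule grafts_graftsl.Cons)
  then show ?case by auto
qed (auto intro: grafts_graftsl.intros)

lemma grafts_Leaves:
  "grafts T (replicate (nleaves T) Leaf) T"
  "graftsl Ts (replicate (sum_list (map nleaves Ts)) Leaf) Ts"
  by (induction T and Ts rule: ptree_forest_induct)
    (auto simp: replicate_add intro: grafts_graftsl.intros)

lemma graftsl_append_iff:
  "graftsl (cs @ ds) as ss \<longleftrightarrow>
    (\<exists>as1 as2 ss1 ss2. as = as1 @ as2 \<and> ss = ss1 @ ss2 \<and> graftsl cs as1 ss1 \<and> graftsl ds as2 ss2)"
proof (induction cs arbitrary: as ss)
  case Nil
  have "graftsl [] as' ss' \<longleftrightarrow> as' = [] \<and> ss' = []" for as' ss'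
    by (auto elim: graftsl_NilE intro: grafts_graftsl.intros)
  then show ?case by simp
next
  case (Cons c cs)
  show ?case
  proof
    assume "graftsl ((c # cs) @ ds) as ss"
    then obtain a1 b1 s1 sr where "as = a1 @ b1" "ss = s1 # sr" "grafts c a1 s1"
      "graftsl (cs @ ds) b1 sr" by (auto elim: graftsl_ConsE)
    then show "\<exists>as1 as2 ss1 ss2. as = as1 @ as2 \<and> ss = ss1 @ ss2 \<and>
        graftsl (c # cs) as1 ss1 \<and> graftsl ds as2 ss2"
      unfolding Cons by (metis append.assoc append_Cons grafts_graftsl.Cons)
  next
    assume "\<exists>as1 as2 ss1 ss2. as = as1 @ as2 \<and> ss = ss1 @ ss2 \<and>
        graftsl (c # cs) as1 ss1 \<and> graftsl ds as2 ss2"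
    then obtain as1 as2 ss1 ss2 where "as = as1 @ as2" "ss = ss1 @ ss2"
        "graftsl (c # cs) as1 ss1" "graftsl ds as2 ss2" by blast
    moreover from this(3) obtain a1 b1 s1 sr where "as1 = a1 @ b1" "ss1 = s1 # sr" "grafts c a1 s1"
      "graftsl cs b1 sr" by (auto elim: graftsl_ConsE)
    moreover from this(4) \<open>graftsl ds as2 ss2\<close> have "graftsl (cs @ ds) (b1 @ as2) (sr @ ss2)"
      unfolding Cons by blast
    ultimately show "graftsl ((c # cs) @ ds) as ss"
      using grafts_graftsl.Cons[of c a1 s1 "cs @ ds" "b1 @ as2" "sr @ ss2"] by simp
  qed
qed

text \<open>Associativity of grafting: the trees \<open>cs\<close> may be extended by
  \<open>as\<close> before or after they are put onto \<open>T\<close>.\<close>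

lemma grafts_grafts:
  "grafts T cs t \<Longrightarrow> graftsl cs as ds \<Longrightarrow> \<exists>u. grafts T ds u \<and> grafts t as u"
  "graftsl Ts cs ts \<Longrightarrow> graftsl cs as ds \<Longrightarrow> \<exists>us. graftsl Ts ds us \<and> graftsl ts as us"
proof (induction arbitrary: as ds and as ds rule: grafts_graftsl.inducts)
  case (Leaf a)
  then show ?case
    by (auto elim!: graftsl_ConsE graftsl_NilE intro: grafts_graftsl.intros)
next
  case (Node cs as ss l)
  then show ?case by (meson grafts_graftsl.Node)
next
  case Nil
  then show ?case by (auto elim!: graftsl_NilE intro: grafts_graftsl.intros)
next
  case (Cons c cs s Ts bs ss as ds)
  from Cons.prems obtain as1 as2 ds1 ds2 where
    "as = as1 @ as2" "ds = ds1 @ ds2" "graftsl cs as1 ds1" "graftsl bs as2 ds2"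
    unfolding graftsl_append_iff by blast
  moreover from this(3) obtain u where "grafts c ds1 u" "grafts s as1 u" using Cons.IH by blast
  moreover from calculation(4) obtain us where "graftsl Ts ds2 us" "graftsl ss as2 us"
    using Cons.IH by blast
  ultimately show ?case using grafts_graftsl.Cons by blast
qed

section \<open>Leaves, vertices and labels under grafting\<close>

lemma nleaves_grafts:
  "grafts T as s \<Longrightarrow> nleaves s = sum_list (map nleaves as)"
  "graftsl cs as ss \<Longrightarrow> sum_list (map nleaves ss) = sum_list (map nleaves as)"
  by (induction rule: grafts_graftsl.inducts) auto

lemma mset_vertex_arities_grafts:
  "grafts T as s \<Longrightarrow>
    mset (vertex_arities s) = mset (vertex_arities T) + mset (concat (map vertex_arities as))"
  "graftsl cs as ss \<Longrightarrow> mset (concat (map vertex_arities ss)) =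
    mset (concat (map vertex_arities cs)) + mset (concat (map vertex_arities as))"
  by (induction rule: grafts_graftsl.inducts) (auto simp: length_grafts)

lemma mset_labels_grafts:
  "grafts T as s \<Longrightarrow> mset (labels s) = mset (labels T) + mset (concat (map labels as))"
  "graftsl cs as ss \<Longrightarrow> mset (concat (map labels ss)) =
    mset (concat (map labels cs)) + mset (concat (map labels as))"
  by (induction rule: grafts_graftsl.inducts) auto

lemma labels_eq_map_fst: "labels t = map fst (vertex_arities t)"
  by (induction t) (auto simp: map_concat cong: map_cong)

text \<open>Trees enter at the leaves from left to right, so deleting the labels of \<open>T\<close>
  from the preorder of the result leaves the preorder of the grafted forest.\<close>

lemma filter_labels_grafts:
  "grafts T as s \<Longrightarrow> \<forall>x\<in>set (labels T). \<not> P x \<Longrightarrow> \<forall>a\<in>set as. \<forall>x\<in>set (labels a). P x \<Longrightarrow>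
    filter P (labels s) = concat (map labels as)"
  "graftsl cs as ss \<Longrightarrow> \<forall>c\<in>set cs. \<forall>x\<in>set (labels c). \<not> P x \<Longrightarrow>
    \<forall>a\<in>set as. \<forall>x\<in>set (labels a). P x \<Longrightarrow>
    filter P (concat (map labels ss)) = concat (map labels as)"
  by (induction rule: grafts_graftsl.inducts) (auto simp: ball_Un simp del: filter_concat)

text \<open>Left inverse of grafting, provided that \<open>A\<close> contains the labels of the
  lower tree and no grafted tree has its root label in \<open>A\<close>.\<close>

fun prune :: "nat set \<Rightarrow> ptree \<Rightarrow> ptree" where
  "prune A Leaf = Leaf"
| "prune A (Node l cs) = (if l \<in> A then Node l (map (prune A) cs) else Leaf)"

lemma prune_grafts:
  "grafts T as s \<Longrightarrow> set (labels T) \<subseteq> A \<Longrightarrow> \<forall>a\<in>set as. prune A a = Leaf \<Longrightarrow> prune A s = T"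
  "graftsl cs as ss \<Longrightarrow> (\<Union>c\<in>set cs. set (labels c)) \<subseteq> A \<Longrightarrow> \<forall>a\<in>set as. prune A a = Leaf \<Longrightarrow>
    map (prune A) ss = cs"
  by (induction rule: grafts_graftsl.inducts) auto

text \<open>Cancellation: following \<open>T\<close> inside \<open>s\<close> up to the leaves of
  \<open>T\<close> finds the grafted trees.\<close>

lemma grafts_inject:
  "grafts T as s \<Longrightarrow> grafts T as' s \<Longrightarrow> as = as'"
  "graftsl cs as ss \<Longrightarrow> graftsl cs as' ss \<Longrightarrow> as = as'"
proof (induction arbitrary: as' and as' rule: grafts_graftsl.inducts)
  case (Cons c as s cs bs ss)
  from Cons.prems obtain as1 bs1 where "as' = as1 @ bs1" "grafts c as1 s" "graftsl cs bs1 ss"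
    by (auto elim: graftsl_ConsE)
  then show ?case using Cons.IH by simp
next
  case (Node cs as ss l)
  from Node.prems show ?case by (rule grafts_NodeE) (use Node.IH in auto)
next
  case (Leaf a)
  then show ?case by (rule grafts_LeafE) auto
next
  case Nil
  then show ?case by (rule graftsl_NilE) auto
qed

text \<open>A vertex is replaced by a tree with one leaf per child. \<open>Leaf\<close> is excluded:
  it is the edge without vertices, which would delete a unary vertex.\<close>

definition family_ok :: "ptree \<Rightarrow> (nat \<Rightarrow> ptree) \<Rightarrow> bool" where
  "family_ok t F \<longleftrightarrow> (\<forall>(l, k)\<in>set (vertex_arities t). F l \<noteq> Leaf \<and> nleaves (F l) = k)"

lemma family_ok_Leaf [simp]: "family_ok Leaf F"
  by (simp add: family_ok_def)

lemma family_ok_Node [simp]: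
  "family_ok (Node l cs) F \<longleftrightarrow>
    F l \<noteq> Leaf \<and> nleaves (F l) = length cs \<and> (\<forall>c\<in>set cs. family_ok c F)"
  by (auto simp: family_ok_def)

lemma grafts_subst:
  assumes "nleaves (F l) = length cs"
  shows "grafts (F l) (map (\<lambda>c. subst c F) cs) (subst (Node l cs) F)"
proof -
  obtain s where "grafts (F l) (map (\<lambda>c. subst c F) cs) s"
    using grafts_exists(1)[of "map (\<lambda>c. subst c F) cs" "F l"] assms by auto
  then show ?thesis using fst_graft_if_grafts by fastforce
qed

lemma subst_cong: "(\<And>l. l \<in> set (labels t) \<Longrightarrow> F l = G l) \<Longrightarrow> subst t F = subst t G"
proof (induction t)
  case (Node l cs)
  have "map (\<lambda>c. subst c F) cs = map (\<lambda>c. subst c G) cs"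
  proof (rule map_cong[OF refl])
    fix c assume c: "c \<in> set cs"
    with Node.prems show "subst c F = subst c G" by (intro Node.IH[OF c]) auto
  qed
  with Node.prems[of l] show ?case by (simp del: map_eq_conv)
qed simp

lemma family_ok_cong:
  "(\<And>l. l \<in> set (labels t) \<Longrightarrow> F l = G l) \<Longrightarrow> family_ok t F \<longleftrightarrow> family_ok t G"
  by (induction t) auto

lemma subst_neq_Leaf: "family_ok t F \<Longrightarrow> t \<noteq> Leaf \<Longrightarrow> subst t F \<noteq> Leaf"
proof (cases t)
  case (Node l cs)
  assume "family_ok t F"
  with Node have "grafts (F l) (map (\<lambda>c. subst c F) cs) (subst t F)" "F l \<noteq> Leaf"
    using grafts_subst[of F l cs] by auto
  then show ?thesis by (cases rule: grafts.cases) auto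
qed simp

lemma nleaves_subst: "family_ok t F \<Longrightarrow> nleaves (subst t F) = nleaves t"
proof (induction t)
  case (Node l cs)
  then have "nleaves (subst (Node l cs) F) = sum_list (map nleaves (map (\<lambda>c. subst c F) cs))"
    by (intro nleaves_grafts(1)[OF grafts_subst]) simp
  also have "\<dots> = nleaves (Node l cs)" using Node
    by (simp add: comp_def cong: map_cong)
  finally show ?case .
qed simp

lemma mset_vertex_arities_subst:
  "family_ok t F \<Longrightarrow>
    mset (vertex_arities (subst t F)) = mset (concat (map (\<lambda>l. vertex_arities (F l)) (labels t)))"
proof (induction t)
  case (Node l cs)
  have "\<forall>c\<in>set cs. mset (vertex_arities (subst c F)) =
      mset (concat (map (\<lambda>l. vertex_arities (F l)) (labels c)))"
    using Node by simp
  then have "mset (concat (map (\<lambda>c. vertex_arities (subst c F)) cs)) =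
      mset (concat (map (\<lambda>l. vertex_arities (F l)) (concat (map labels cs))))"
    by (induction cs) auto
  then show ?case
    using mset_vertex_arities_grafts(1)[OF grafts_subst, of F l cs] Node.prems
    by (simp add: comp_def)
qed simp

text \<open>Counting with multiplicity lets distinctness of the labels of the result turn into
  disjointness of the substituted trees.\<close>

lemma mset_labels_subst:
  assumes "family_ok t F"
  shows "mset (labels (subst t F)) = mset (concat (map (\<lambda>l. labels (F l)) (labels t)))"
  using arg_cong[OF mset_vertex_arities_subst[OF assms], of "image_mset fst"]
  by (simp only: labels_eq_map_fst mset_map map_concat flip: mset_map) (simp add: comp_def)

lemma set_vertex_arities_subst:
  "family_ok t F \<Longrightarrow>
    set (vertex_arities (subst t F)) = (\<Union>l\<in>set (labels t). set (vertex_arities (F l)))"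
  using mset_vertex_arities_subst[THEN mset_eq_setD] by force

lemma set_labels_subst:
  "family_ok t F \<Longrightarrow> set (labels (subst t F)) = (\<Union>l\<in>set (labels t). set (labels (F l)))"
  using mset_labels_subst[THEN mset_eq_setD] by force

lemma family_ok_subst_iff:
  "family_ok t F \<Longrightarrow> family_ok (subst t F) G \<longleftrightarrow> (\<forall>l\<in>set (labels t). family_ok (F l) G)"
  unfolding family_ok_def[of _ G] by (auto simp: set_vertex_arities_subst)

text \<open>At a node both sides regroup one grafting onto \<open>G l\<close>; associativity in
  \<open>grafts_grafts\<close> and uniqueness of the result reconcile them.\<close>

lemma subst_grafts:
  "grafts T as s \<Longrightarrow> family_ok T G \<Longrightarrow>
    grafts (subst T G) (map (\<lambda>a. subst a G) as) (subst s G)"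
  "graftsl cs as ss \<Longrightarrow> \<forall>c\<in>set cs. family_ok c G \<Longrightarrow>
    graftsl (map (\<lambda>c. subst c G) cs) (map (\<lambda>a. subst a G) as) (map (\<lambda>s. subst s G) ss)"
proof (induction rule: grafts_graftsl.inducts)
  case (Node cs as ss l)
  have len: "nleaves (G l) = length cs" "nleaves (G l) = length ss"
    using Node length_grafts(2)[OF Node.hyps] by auto
  have "graftsl (map (\<lambda>c. subst c G) cs) (map (\<lambda>a. subst a G) as) (map (\<lambda>s. subst s G) ss)"
    using Node by auto
  from grafts_grafts(1)[OF grafts_subst[where F=G, OF len(1)] this]
  show ?case using grafts_determ[OF grafts_subst[where F=G, OF len(2)]] by auto
qed (auto intro: grafts_graftsl.intros)

text \<open>By \<open>subst_grafts\<close> the left side is a grafting onto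
  \<open>subst (F l) G\<close>; by induction the grafted subtrees are those of the right side, and
  grafting is single-valued.\<close>

lemma subst_subst:
  "family_ok p F \<Longrightarrow> \<forall>l\<in>set (labels p). family_ok (F l) G \<Longrightarrow>
    subst (subst p F) G = subst p (\<lambda>l. subst (F l) G)"
proof (induction p)
  case (Node l cs)
  then have len: "nleaves (F l) = length cs" and ok: "family_ok (F l) G" by auto
  then have len': "nleaves (subst (F l) G) = length cs" by (simp add: nleaves_subst)
  have "map (\<lambda>a. subst a G) (map (\<lambda>c. subst c F) cs) = map (\<lambda>c. subst c (\<lambda>l. subst (F l) G)) cs"
    using Node by simp
  then have "grafts (subst (F l) G) (map (\<lambda>c. subst c (\<lambda>l. subst (F l) G)) cs)
      (subst (subst (Node l cs) F) G)"
    using subst_grafts(1)[OF grafts_subst[where F=F, OF len] ok] by (simp only:)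
  then show ?case
    by (rule grafts_determ[OF _ grafts_subst[where F="\<lambda>l. subst (F l) G", OF len']])
qed simp

lemma family_ok_subst:
  assumes "family_ok p F" "\<forall>l\<in>set (labels p). family_ok (F l) G"
  shows "family_ok p (\<lambda>l. subst (F l) G)"
  unfolding family_ok_def
proof (intro ballI, clarify)
  fix l k assume lk: "(l, k) \<in> set (vertex_arities p)"
  then have "l \<in> set (labels p)" by (force simp: labels_eq_map_fst)
  then show "subst (F l) G \<noteq> Leaf \<and> nleaves (subst (F l) G) = k"
    using lk assms by (auto simp: family_ok_def[of p] nleaves_subst subst_neq_Leaf)
qed

section \<open>Recovering a family from its substitution\<close>

lemma prune_subst_eq_Leaf:
  assumes "family_ok t F" "set (labels (subst t F)) \<inter> A = {}"
  shows "prune A (subst t F) = Leaf"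
  using assms by (cases "subst t F") auto

lemma distinct_labels_subst_Node:
  assumes "distinct (labels (subst (Node l cs) F))" "family_ok (Node l cs) F"
  shows "distinct (labels (F l))"
    "c \<in> set cs \<Longrightarrow> distinct (labels (subst c F))"
    "c \<in> set cs \<Longrightarrow> set (labels (subst c F)) \<inter> set (labels (F l)) = {}"
proof -
  have len: "nleaves (F l) = length cs" using assms by simp
  have m: "mset (labels (subst (Node l cs) F)) =
      mset (labels (F l) @ concat (map (\<lambda>c. labels (subst c F)) cs))"
    using mset_labels_grafts(1)[OF grafts_subst[where F=F, OF len]] by (simp add: comp_def)
  then have d: "distinct (labels (F l) @ concat (map (\<lambda>c. labels (subst c F)) cs))"
    using mset_eq_imp_distinct_iff[OF m] assms by blast
  then show "distinct (labels (F l))" by simp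
  show "distinct (labels (subst c F))" "set (labels (subst c F)) \<inter> set (labels (F l)) = {}"
    if "c \<in> set cs"
    using d that by (auto simp: distinct_concat_iff)
qed

text \<open>A substitution can be undone: the tree at the root vertex is the result of pruning away all
  vertices carrying a foreign label.\<close>

lemma subst_inject:
  assumes "family_ok t F" "family_ok t G" "subst t F = subst t G"
    "distinct (labels (subst t F))"
    "\<forall>l\<in>set (labels t). set (labels (F l)) = set (labels (G l))" "l \<in> set (labels t)"
  shows "F l = G l"
  using assms
proof (induction t)
  case (Node k cs)
  let ?A = "set (labels (F k))"
  have F: "grafts (F k) (map (\<lambda>c. subst c F) cs) (subst (Node k cs) F)"
    and G: "grafts (G k) (map (\<lambda>c. subst c G) cs) (subst (Node k cs) F)"
    using Node.prems grafts_subst[of F k cs] grafts_subst[of G k cs] by auto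
  have A: "set (labels (G k)) = ?A" using Node.prems by simp
  \<comment> \<open>Labels are distinct, so no subtree above the root block carries a label of
    \<open>?A\<close>, and pruning stops at its root.\<close>
  have "set (labels (subst c F)) \<inter> ?A = {}" "set (labels (subst c G)) \<inter> ?A = {}" if "c \<in> set cs" for c
    using Node.prems(1-4) A that distinct_labels_subst_Node(3)[where F=F and l=k and cs=cs]
      distinct_labels_subst_Node(3)[where F=G and l=k and cs=cs] by metis+
  then have Leaf: "\<forall>a\<in>set (map (\<lambda>c. subst c F) cs). prune ?A a = Leaf"
    "\<forall>a\<in>set (map (\<lambda>c. subst c G) cs). prune ?A a = Leaf"
    using Node.prems(1,2) by (auto intro!: prune_subst_eq_Leaf)
  have "prune ?A (subst (Node k cs) F) = F k"
    by (rule prune_grafts(1)[OF F _ Leaf(1)]) simp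
  moreover have "prune ?A (subst (Node k cs) F) = G k"
    by (rule prune_grafts(1)[OF G _ Leaf(2)]) (simp add: A)
  ultimately have k: "F k = G k" by simp
  \<comment> \<open>Both sides now share the root block, so cancellation for grafting identifies the
    subtrees above it.\<close>
  have "map (\<lambda>c. subst c F) cs = map (\<lambda>c. subst c G) cs"
    by (rule grafts_inject(1)[OF F G[folded k]])
  then have eq: "subst c F = subst c G" if "c \<in> set cs" for c
    using that by simp
  show ?case
  proof (cases "l = k")
    case False
    then obtain c where c: "c \<in> set cs" "l \<in> set (labels c)" using Node.prems(6) by auto
    have "distinct (labels (subst c F))"
      using distinct_labels_subst_Node(2)[OF Node.prems(4,1) c(1)] .
    then show ?thesis using Node.IH[OF c(1)] Node.prems eq[OF c(1)] c by auto
  qed (simp add: k)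
qed simp

section \<open>Morphisms as families of trees\<close>

lemma labels_relabel [simp]: "labels (relabel f t) = map f (labels t)"
  by (induction t) (auto simp: map_concat comp_def cong: map_cong)

lemma nleaves_relabel [simp]: "nleaves (relabel f t) = nleaves t"
  by (induction t) (auto simp: comp_def cong: map_cong)

lemma relabel_eq_Leaf_iff [simp]: "relabel f t = Leaf \<longleftrightarrow> t = Leaf"
  by (cases t) auto

lemma relabel_relabel: "relabel f (relabel g t) = relabel (f \<circ> g) t"
  by (induction t) auto

lemma relabel_ident: "(\<And>x. x \<in> set (labels t) \<Longrightarrow> f x = x) \<Longrightarrow> relabel f t = t"
  by (induction t) (auto intro!: map_idI)

lemma subst_relabel: "subst (relabel f t) G = subst t (G \<circ> f)"
  by (induction t) (auto simp: comp_def cong: map_cong)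

lemma count_less_nth:
  "sorted_wrt (<) xs \<Longrightarrow> i < length xs \<Longrightarrow> length (filter (\<lambda>y. y < xs ! i) xs) = i"
  for xs :: "nat list"
proof (induction xs arbitrary: i)
  case (Cons a xs)
  then show ?case
    by (cases i) (auto simp: filter_empty_conv dest: order.asym)
qed simp

text \<open>The same rank function as in \<open>ncomp\<close>; the \<open>+ 1\<close> is there
  because vertices are numbered from 1.\<close>

definition normalize :: "ptree \<Rightarrow> ptree" where
  "normalize t = relabel (\<lambda>x. length (filter (\<lambda>y. y < x) (sort (labels t))) + 1) t"

lemma sorted_wrt_sort_labels: "distinct (labels t) \<Longrightarrow> sorted_wrt (<) (sort (labels t))"
  by (simp add: strict_sorted_iff)

lemma normalize_inverse:
  assumes "distinct (labels t)"
  shows "relabel (\<lambda>j. sort (labels t) ! (j - 1)) (normalize t) = t"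
  unfolding normalize_def relabel_relabel
proof (rule relabel_ident)
  fix x assume "x \<in> set (labels t)"
  then obtain i where "i < length (sort (labels t))" "x = sort (labels t) ! i"
    by (metis in_set_conv_nth set_sort)
  then show "((\<lambda>j. sort (labels t) ! (j - 1)) \<circ>
      (\<lambda>x. length (filter (\<lambda>y. y < x) (sort (labels t))) + 1)) x = x"
    using count_less_nth[OF sorted_wrt_sort_labels[OF assms]] by simp
qed

lemma is_ptree_normalize:
  assumes "distinct (labels t)" "t \<noteq> Leaf"
  shows "is_ptree (normalize t)"
proof -
  let ?S = "sort (labels t)"
  let ?r = "\<lambda>x. length (filter (\<lambda>y. y < x) ?S) + 1"
  have r: "?r (?S ! i) = i + 1" if "i < length ?S" for i
    using count_less_nth[OF sorted_wrt_sort_labels[OF assms(1)] that] by simp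
  have "set ?S = (!) ?S ` {..<length ?S}" unfolding set_conv_nth by blast
  then have S: "set (labels t) = (!) ?S ` {..<length ?S}" by simp
  have "?r ` set (labels t) = (\<lambda>i. i + 1) ` {..<length ?S}"
    unfolding S image_image using r by (intro image_cong) auto
  also have "\<dots> = {1..length ?S}"
    by (auto simp: image_iff Bex_def) presburger
  finally have "?r ` set (labels t) = {1..length (labels t)}" by simp
  moreover from this have "inj_on ?r (set (labels t))"
    using assms(1) by (intro eq_card_imp_inj_on) (auto simp: distinct_card)
  ultimately show ?thesis
    using assms unfolding is_ptree_def nverts_def normalize_def
    by (simp add: distinct_map)
qed

text \<open>Converse of \<open>normalize_inverse\<close>: a tree numbered from 1 together with an
  increasing list is the same data as a tree with arbitrary distinct labels.\<close>

lemma relabel_nth: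
  assumes "is_ptree t" "sorted_wrt (<) s" "length s = nverts t"
  shows "sort (labels (relabel (\<lambda>j. s ! (j - 1)) t)) = s"
    and "normalize (relabel (\<lambda>j. s ! (j - 1)) t) = t"
proof -
  have L: "set (labels t) = {1..length s}" "distinct (labels t)"
    using assms by (auto simp: is_ptree_def)
  have "(\<lambda>j. s ! (j - 1)) ` {1..length s} = set s"
    by (force simp: set_conv_nth image_iff intro!: bexI[where x="Suc _"])
  moreover from this have "inj_on (\<lambda>j. s ! (j - 1)) {1..length s}"
    using assms(2) by (intro eq_card_imp_inj_on) (auto simp: distinct_card strict_sorted_iff)
  ultimately show s: "sort (labels (relabel (\<lambda>j. s ! (j - 1)) t)) = s"
    using L assms(2)
    by (intro sorted_distinct_set_unique) (auto simp: distinct_map strict_sorted_iff)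
  show "normalize (relabel (\<lambda>j. s ! (j - 1)) t) = t"
    unfolding normalize_def s relabel_relabel
    by (rule relabel_ident) (use L count_less_nth[OF assms(2)] in auto)
qed

section \<open>Morphisms versus families of trees\<close>

definition family :: "nmor \<Rightarrow> nat \<Rightarrow> ptree" where
  "family m = subst_family (mtrees m) (mshuf m)"

text \<open>Inverse to \<open>family\<close>, which labels each tree by vertices of the target and
  so absorbs the bijection; sorting the labels gives the bijection back.\<close>

definition nmor_of :: "ptree \<Rightarrow> ptree \<Rightarrow> (nat \<Rightarrow> ptree) \<Rightarrow> nmor" where
  "nmor_of p q F = \<lparr> msrc = p, mtrees = map (\<lambda>l. normalize (F l)) [1..<nverts p + 1],
     mshuf = map (\<lambda>l. sort (labels (F l))) [1..<nverts p + 1], mtgt = q \<rparr>"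

lemma nmor_of_cong:
  "(\<And>l. l \<in> {1..nverts p} \<Longrightarrow> F l = G l) \<Longrightarrow> nmor_of p q F = nmor_of p q G"
  by (auto simp: nmor_of_def)

lemma set_labels_is_ptree: "is_ptree p \<Longrightarrow> set (labels p) = {1..nverts p}"
  and distinct_labels_is_ptree: "is_ptree p \<Longrightarrow> distinct (labels p)"
  by (auto simp: is_ptree_def)

lemma arity_eq:
  assumes "is_ptree p" "(l, k) \<in> set (vertex_arities p)"
  shows "arity p l = k"
  using map_of_is_SomeI[of "vertex_arities p" l k] assms
  by (simp add: arity_def is_ptree_def labels_eq_map_fst)

lemma arity_mem:
  assumes "is_ptree p" "l \<in> set (labels p)"
  shows "(l, arity p l) \<in> set (vertex_arities p)"
  using assms arity_eq by (force simp: labels_eq_map_fst)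

lemma mset_concat_map_cong:
  assumes "mset xs = mset ys" "\<And>x. x \<in> set xs \<Longrightarrow> mset (f x) = mset (g x)"
  shows "mset (concat (map f xs)) = mset (concat (map g ys))"
proof -
  have "mset (concat (map h zs)) = sum_mset (image_mset (\<lambda>x. mset (h x)) (mset zs))" for h :: "'a \<Rightarrow> 'b list" and zs
    by (induction zs) auto
  moreover have "image_mset (\<lambda>x. mset (f x)) (mset xs) = image_mset (\<lambda>x. mset (g x)) (mset ys)"
    using assms by (metis (no_types, lifting) image_mset_cong set_mset_mset)
  ultimately show ?thesis by simp
qed

lemma map_upt_eqI:
  "length xs = n \<Longrightarrow> (\<And>l. l \<in> {1..n} \<Longrightarrow> f l = xs ! (l - 1)) \<Longrightarrow> map f [1..<n + 1] = xs"
  by (rule nth_equalityI) (auto simp del: upt_Suc)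

lemma is_nmorD:
  assumes "is_nmor p q m"
  shows "is_ptree p" "is_ptree q" "msrc m = p" "mtgt m = q" "family_ok p (family m)"
    "subst p (family m) = q" "nmor_of p q (family m) = m"
proof -
  show p: "is_ptree p" and "is_ptree q" "msrc m = p" "mtgt m = q" "subst p (family m) = q"
    using assms by (auto simp: is_nmor_def family_def)
  have m: "is_ptree (mtrees m ! (l - 1))" "nleaves (mtrees m ! (l - 1)) = arity p l"
    "length (mshuf m ! (l - 1)) = nverts (mtrees m ! (l - 1))"
    "sorted_wrt (<) (mshuf m ! (l - 1))" if "l \<in> {1..nverts p}" for l
    using assms that by (auto simp: is_nmor_def)
  show "family_ok p (family m)"
    unfolding family_ok_def
  proof (intro ballI, clarify)
    fix l k assume lk: "(l, k) \<in> set (vertex_arities p)"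
    then have "l \<in> set (labels p)" by (force simp: labels_eq_map_fst)
    then show "family m l \<noteq> Leaf \<and> nleaves (family m l) = k"
      using m[of l] arity_eq[OF p lk] set_labels_is_ptree[OF p]
      by (auto simp: family_def subst_family_def is_ptree_def)
  qed
  have "normalize (family m l) = mtrees m ! (l - 1)" "sort (labels (family m l)) = mshuf m ! (l - 1)"
    if "l \<in> {1..nverts p}" for l
    unfolding family_def subst_family_def
    using relabel_nth[OF m(1)[OF that] m(4)[OF that] m(3)[OF that]] by auto
  then have "map (\<lambda>l. normalize (family m l)) [1..<nverts p + 1] = mtrees m"
    "map (\<lambda>l. sort (labels (family m l))) [1..<nverts p + 1] = mshuf m"
    using assms by (intro map_upt_eqI; simp add: is_nmor_def)+
  then show "nmor_of p q (family m) = m"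
    using assms by (simp add: is_nmor_def nmor_of_def del: upt_Suc)
qed

text \<open>Disjointness of the blocks comes from the target: their labels together are those of
  \<open>q\<close>, without repetition.\<close>

lemma nmor_of:
  assumes "is_ptree p" "is_ptree q" "family_ok p F" "subst p F = q"
  shows "is_nmor p q (nmor_of p q F)"
    and "l \<in> {1..nverts p} \<Longrightarrow> family (nmor_of p q F) l = F l"
proof -
  have lab: "set (labels p) = {1..nverts p}" using assms(1) by (simp add: is_ptree_def)
  have mq: "mset (labels q) = mset (concat (map (\<lambda>l. labels (F l)) (labels p)))"
    using mset_labels_subst[OF assms(3)] assms(4) by simp
  have "distinct (concat (map (\<lambda>l. labels (F l)) (labels p)))"
    using mset_eq_imp_distinct_iff[OF mq] assms(2) by (simp add: is_ptree_def)
  then have dist: "distinct (labels (F l))" if "l \<in> {1..nverts p}" for l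
    using that lab by (auto simp: distinct_concat_iff)
  have F: "F l \<noteq> Leaf" "nleaves (F l) = arity p l" if "l \<in> {1..nverts p}" for l
    using assms(3) arity_mem[OF assms(1), of l] that lab by (auto simp: family_ok_def)
  have nth: "mtrees (nmor_of p q F) ! (l - 1) = normalize (F l)"
    "mshuf (nmor_of p q F) ! (l - 1) = sort (labels (F l))" if "l \<in> {1..nverts p}" for l
    using that by (auto simp: nmor_of_def simp del: upt_Suc)
  show fam: "family (nmor_of p q F) l = F l" if "l \<in> {1..nverts p}" for l
    using normalize_inverse[OF dist[OF that]] nth[OF that] by (simp add: family_def subst_family_def)
  \<comment> \<open>\<open>mshuf\<close> lists the blocks in numerical order, substitution in
    preorder of \<open>p\<close>; as multisets the two agree.\<close>
  have "mset (labels p) = mset [1..<nverts p + 1]"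
    using lab by (intro iffD1[OF set_eq_iff_mset_eq_distinct] distinct_labels_is_ptree assms(1))
      (simp_all add: atLeastLessThanSuc_atLeastAtMost del: upt_Suc)
  then have "mset (concat (mshuf (nmor_of p q F))) = mset (labels q)"
    unfolding mq nmor_of_def nmor.simps by (intro mset_concat_map_cong) (simp_all del: upt_Suc)
  from mset_eq_imp_distinct_iff[OF this] mset_eq_setD[OF this]
  have "distinct (concat (mshuf (nmor_of p q F)))"
    "set (concat (mshuf (nmor_of p q F))) = {1..nverts q}"
    using assms(2) unfolding is_ptree_def by (simp_all only:)
  moreover have "q = subst p (family (nmor_of p q F))"
    unfolding assms(4)[symmetric] using fam lab by (intro subst_cong) (simp add: assms(4))
  moreover have "is_ptree (mtrees (nmor_of p q F) ! (l - 1)) \<and>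
      nleaves (mtrees (nmor_of p q F) ! (l - 1)) = arity p l \<and>
      length (mshuf (nmor_of p q F) ! (l - 1)) = nverts (mtrees (nmor_of p q F) ! (l - 1)) \<and>
      sorted_wrt (<) (mshuf (nmor_of p q F) ! (l - 1))" if "l \<in> {1..nverts p}" for l
    unfolding nth[OF that] using is_ptree_normalize[OF dist[OF that] F(1)[OF that]] F(2)[OF that]
      sorted_wrt_sort_labels[OF dist[OF that]]
    by (simp add: normalize_def nverts_def)
  moreover have "msrc (nmor_of p q F) = p" "mtgt (nmor_of p q F) = q"
    "length (mtrees (nmor_of p q F)) = nverts p" "length (mshuf (nmor_of p q F)) = nverts p"
    by (simp_all add: nmor_of_def)
  ultimately show "is_nmor p q (nmor_of p q F)"
    using assms(1,2) unfolding is_nmor_def family_def by (intro conjI ballI) simp_all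
qed

text \<open>By \<open>subst_relabel\<close>, renaming vertices before substituting amounts to
  looking up the family at the renamed vertices. Composition becomes substitution of families, and
  the renumbering is confined to \<open>nmor_of\<close>.\<close>

lemma ncomp_eq:
  assumes "is_nmor p q f"
  shows "ncomp g f = nmor_of p (mtgt g) (\<lambda>l. subst (family f l) (family g))"
proof -
  have "subst (mtrees f ! (l - 1))
      (\<lambda>j. subst_family (mtrees g) (mshuf g) (mshuf f ! (l - 1) ! (j - 1))) =
    subst (family f l) (family g)" for l
    by (simp add: family_def subst_family_def[of "mtrees f"] subst_relabel comp_def)
  then show ?thesis
    using assms by (simp add: ncomp_def Let_def nmor_of_def normalize_def is_nmor_def del: upt_Suc)
qed

section \<open>Identities and composites in terms of families\<close>

definition id_family :: "ptree \<Rightarrow> nat \<Rightarrow> ptree" where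
  "id_family p l = Node l (replicate (arity p l) Leaf)"

lemma nid_eq: "nid p = nmor_of p p (id_family p)"
  by (simp add: nid_def nmor_of_def corolla_def normalize_def id_family_def del: upt_Suc)

lemma grafts_corolla:
  "graftsl (replicate (length as) Leaf) as as"
  "grafts (Node l (replicate (length as) Leaf)) as (Node l as)"
proof -
  show "graftsl (replicate (length as) Leaf) as as"
    by (induction as) (use grafts_graftsl.Cons[OF grafts_graftsl.Leaf] grafts_graftsl.Nil in auto)
  then show "grafts (Node l (replicate (length as) Leaf)) as (Node l as)"
    by (rule grafts_graftsl.Node)
qed

text \<open>One of the two unit laws: grafting subtrees onto a corolla rebuilds the node. The other
  is \<open>subst_corolla\<close>.\<close>

lemma subst_corollas:
  "\<forall>(l, k)\<in>set (vertex_arities t). F l = Node l (replicate k Leaf) \<Longrightarrow> subst t F = t"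
proof (induction t)
  case (Node l cs)
  then have "F l = Node l (replicate (length cs) Leaf)"
    and "map (\<lambda>c. subst c F) cs = cs" by (auto intro!: map_idI)
  then show ?case using fst_graft_if_grafts[OF grafts_corolla(2)] by simp
qed simp

lemma subst_corolla:
  assumes "nleaves (F l) = k"
  shows "subst (Node l (replicate k Leaf)) F = F l"
  using fst_graft_if_grafts[OF grafts_Leaves(1), of "F l"] assms by (simp add: comp_def)

lemma id_family:
  assumes "is_ptree p"
  shows "family_ok p (id_family p)" "subst p (id_family p) = p"
  using assms arity_eq
  by (auto simp: family_ok_def id_family_def sum_list_replicate intro!: subst_corollas)

lemma
  assumes "is_nmor p q f" "is_nmor q r g"
  shows is_nmor_ncomp: "is_nmor p r (ncomp g f)"
    and family_ncomp: "l \<in> {1..nverts p} \<Longrightarrow> family (ncomp g f) l = subst (family f l) (family g)"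
proof -
  note f = is_nmorD[OF assms(1)] and g = is_nmorD[OF assms(2)]
  have ok: "\<forall>l\<in>set (labels p). family_ok (family f l) (family g)"
    using family_ok_subst_iff[OF f(5)] f(6) g(5) by blast
  have "family_ok p (\<lambda>l. subst (family f l) (family g))"
    using family_ok_subst[OF f(5) ok] .
  moreover have "subst p (\<lambda>l. subst (family f l) (family g)) = r"
    using subst_subst[OF f(5) ok] f(6) g(6) by simp
  ultimately show "is_nmor p r (ncomp g f)"
    and "l \<in> {1..nverts p} \<Longrightarrow> family (ncomp g f) l = subst (family f l) (family g)"
    unfolding ncomp_eq[OF assms(1)] g(4) using nmor_of[OF f(1) g(2)] by auto
qed

lemma
  assumes "is_ptree p"
  shows is_nmor_nid: "is_nmor p p (nid p)"
    and family_nid: "l \<in> {1..nverts p} \<Longrightarrow> family (nid p) l = id_family p l"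
  unfolding nid_eq using nmor_of[OF assms assms id_family[OF assms]] by auto

lemma nmor_eqI:
  assumes "is_nmor p q f" "is_nmor p q g" "\<And>l. l \<in> {1..nverts p} \<Longrightarrow> family f l = family g l"
  shows "f = g"
proof -
  have "f = nmor_of p q (family f)" using is_nmorD(7)[OF assms(1)] ..
  also have "\<dots> = nmor_of p q (family g)" using assms(3) by (rule nmor_of_cong)
  also have "\<dots> = g" by (rule is_nmorD(7)[OF assms(2)])
  finally show ?thesis .
qed

section \<open>The category laws\<close>

lemma set_vertex_arities_family_subset:
  assumes "is_nmor p q f" "l \<in> {1..nverts p}"
  shows "set (vertex_arities (family f l)) \<subseteq> set (vertex_arities q)"
  using set_vertex_arities_subst[OF is_nmorD(5)[OF assms(1)]] assms(2) is_nmorD(6)[OF assms(1)]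
    set_labels_is_ptree[OF is_nmorD(1)[OF assms(1)]] by auto

lemma set_labels_family_subset:
  assumes "is_nmor p q f" "l \<in> {1..nverts p}"
  shows "set (labels (family f l)) \<subseteq> {1..nverts q}"
  using set_vertex_arities_family_subset[OF assms] set_labels_is_ptree[OF is_nmorD(2)[OF assms(1)]]
  unfolding labels_eq_map_fst by auto

lemma nleaves_family:
  assumes "is_nmor p q f" "l \<in> {1..nverts p}"
  shows "nleaves (family f l) = arity p l" "family f l \<noteq> Leaf"
proof -
  have "(l, arity p l) \<in> set (vertex_arities p)"
    using arity_mem[OF is_nmorD(1)[OF assms(1)]] assms(2)
      set_labels_is_ptree[OF is_nmorD(1)[OF assms(1)]] by simp
  then show "nleaves (family f l) = arity p l" "family f l \<noteq> Leaf"
    using is_nmorD(5)[OF assms(1)] by (auto simp: family_ok_def)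
qed

text \<open>On families, associativity is \<open>subst_subst\<close> applied to each tree of
  \<open>f\<close>.\<close>

lemma ncomp_assoc:
  assumes "is_nmor a b f" "is_nmor b c g" "is_nmor c d h"
  shows "ncomp h (ncomp g f) = ncomp (ncomp h g) f"
proof (rule nmor_eqI)
  show 1: "is_nmor a d (ncomp h (ncomp g f))" "is_nmor a d (ncomp (ncomp h g) f)"
    using assms is_nmor_ncomp by blast+
  fix l assume l: "l \<in> {1..nverts a}"
  note f = is_nmorD[OF assms(1)] and g = is_nmorD[OF assms(2)] and h = is_nmorD[OF assms(3)]
  have la: "l \<in> set (labels a)" using l set_labels_is_ptree[OF f(1)] by simp
  have gok: "family_ok (family f l) (family g)"
    using family_ok_subst_iff[OF f(5), of "family g"] f(6) g(5) la by simp
  have "\<forall>j\<in>set (labels b). family_ok (family g j) (family h)"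
    using family_ok_subst_iff[OF g(5), of "family h"] g(6) h(5) by simp
  then have hok: "\<forall>j\<in>set (labels (family f l)). family_ok (family g j) (family h)"
    using set_labels_family_subset[OF assms(1) l] set_labels_is_ptree[OF f(2)] by blast
  have "family (ncomp h (ncomp g f)) l = subst (subst (family f l) (family g)) (family h)"
    using family_ncomp[OF is_nmor_ncomp[OF assms(1,2)] assms(3) l] family_ncomp[OF assms(1,2) l]
    by simp
  also have "\<dots> = subst (family f l) (\<lambda>j. subst (family g j) (family h))"
    by (rule subst_subst[OF gok hok])
  also have "\<dots> = subst (family f l) (family (ncomp h g))"
    using family_ncomp[OF assms(2,3)] set_labels_family_subset[OF assms(1) l]
    by (intro subst_cong) auto
  also have "\<dots> = family (ncomp (ncomp h g) f) l"
    using family_ncomp[OF assms(1) is_nmor_ncomp[OF assms(2,3)] l] by simp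
  finally show "family (ncomp h (ncomp g f)) l = family (ncomp (ncomp h g) f) l" .
qed

lemma ncomp_nid:
  assumes "is_nmor p q f"
  shows "ncomp (nid q) f = f" "ncomp f (nid p) = f"
proof -
  note f = is_nmorD[OF assms]
  note p = is_nmor_nid[OF f(1)] and q = is_nmor_nid[OF f(2)]
  show "ncomp (nid q) f = f"
  proof (rule nmor_eqI[OF is_nmor_ncomp[OF assms q] assms])
    fix l assume l: "l \<in> {1..nverts p}"
    have "subst (family f l) (family (nid q)) = family f l"
    proof (rule subst_corollas, clarify)
      fix j k assume "(j, k) \<in> set (vertex_arities (family f l))"
      then have jk: "(j, k) \<in> set (vertex_arities q)"
        using set_vertex_arities_family_subset[OF assms l] by blast
      then have "j \<in> {1..nverts q}"
        unfolding set_labels_is_ptree[OF f(2), symmetric] labels_eq_map_fst by force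
      then show "family (nid q) j = Node j (replicate k Leaf)"
        using family_nid[OF f(2)] arity_eq[OF f(2) jk] by (simp add: id_family_def)
    qed
    then show "family (ncomp (nid q) f) l = family f l"
      using family_ncomp[OF assms q l] by simp
  qed
  show "ncomp f (nid p) = f"
    by (rule nmor_eqI[OF is_nmor_ncomp[OF p assms] assms])
      (simp add: family_ncomp[OF p assms] family_nid[OF f(1)] id_family_def subst_corolla
        nleaves_family[OF assms] del: subst.simps)
qed

lemma is_category_nupOp_op: "is_category nupOp_op"
  unfolding is_category_def nupOp_op_def
  by (auto simp: is_nmor_nid is_nmor_ncomp ncomp_assoc ncomp_nid dest: is_nmorD(3,4)
      intro: is_nmor_ncomp ncomp_assoc)

section \<open>The lexicographic order\<close>

fun firsts :: "'a list \<Rightarrow> 'a list" where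
  "firsts [] = []"
| "firsts (x # xs) = x # filter (\<lambda>y. y \<noteq> x) (firsts xs)"

lemma filter_firsts: "filter P (firsts xs) = firsts (filter P xs)"
proof (induction xs)
  case (Cons x xs)
  have "filter P (filter (\<lambda>y. y \<noteq> x) (firsts xs)) = filter (\<lambda>y. y \<noteq> x) (filter P (firsts xs))"
    by (simp add: conj_commute)
  moreover have "\<not> P x \<Longrightarrow> filter P (filter (\<lambda>y. y \<noteq> x) (firsts xs)) = filter P (firsts xs)"
    by (auto intro!: filter_cong)
  ultimately show ?case using Cons by (auto simp del: filter_filter)
qed simp

lemma set_firsts [simp]: "set (firsts xs) = set xs"
  by (induction xs) auto

lemma firsts_append:
  "set xs \<inter> set ys = {} \<Longrightarrow> firsts (xs @ ys) = firsts xs @ firsts ys"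
proof (induction xs)
  case (Cons x xs)
  then have "filter (\<lambda>y. y \<noteq> x) (firsts ys) = firsts ys" by (intro filter_True) auto
  with Cons show ?case by simp
qed simp

text \<open>The deleted positions carry equal letters in both words, so restoring them affects
  neither the first difference nor the equality of lengths.\<close>

lemma lenlex_filter:
  assumes "\<alpha> x = \<beta> x"
    "(map \<alpha> (filter (\<lambda>y. y \<noteq> x) L), map \<beta> (filter (\<lambda>y. y \<noteq> x) L)) \<in> lenlex less_than"
  shows "(map \<alpha> L, map \<beta> L) \<in> lenlex less_than"
  using assms(2) by (induction L) (auto simp: Cons_lenlex_iff assms(1) split: if_splits)

text \<open>Two letterwise images of one word can first differ only where a letter of
  \<open>w\<close> occurs for the first time.\<close>

lemma lenlex_firsts:
  "(map \<alpha> (firsts w), map \<beta> (firsts w)) \<in> lenlex less_than \<Longrightarrow>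
    (map \<alpha> w, map \<beta> w) \<in> lenlex less_than"
proof (induction w)
  case (Cons x w)
  then show ?case using lenlex_filter[of \<alpha> x \<beta> "firsts w"] by (auto simp: Cons_lenlex_iff)
qed simp

text \<open>The vertices of each substituted tree appear in the preorder listing of the result starting
  with its root, so listing the blocks by first occurrence recovers the preorder of the base tree.\<close>

lemma firsts_labels_subst:
  assumes "family_ok t F" "distinct (labels t)" "\<forall>l\<in>set (labels t). \<forall>v\<in>set (labels (F l)). \<phi> v = l"
  shows "firsts (map \<phi> (labels (subst t F))) = labels t"
  using assms
proof (induction t)
  case (Node l cs)
  obtain x us where Fl: "F l = Node x us" using Node.prems(1) by (cases "F l") auto
  have g: "grafts (F l) (map (\<lambda>c. subst c F) cs) (subst (Node l cs) F)"
    by (rule grafts_subst) (use Node.prems in simp)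
  from g have "\<exists>ss. subst (Node l cs) F = Node x ss"
    unfolding Fl by (rule grafts_NodeE) blast
  then obtain ss where ss: "subst (Node l cs) F = Node x ss" ..
  have x: "\<phi> x = l" using Node.prems(3) Fl by simp
  \<comment> \<open>A vertex above the root block lies in the block of some vertex of
    \<open>c\<close>, hence not in that of \<open>l\<close>.\<close>
  have sub: "\<phi> v \<in> set (labels c)" "\<phi> v \<noteq> l" if cv: "c \<in> set cs" "v \<in> set (labels (subst c F))" for c v
  proof -
    have "family_ok c F" using Node.prems(1) cv(1) by simp
    then obtain m where m: "m \<in> set (labels c)" "v \<in> set (labels (F m))"
      using set_labels_subst cv(2) by blast
    have "m \<in> set (labels (Node l cs))" using m(1) cv(1) by auto
    then have "\<phi> v = m" using Node.prems(3) m(2) by blast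
    moreover have "m \<noteq> l" using Node.prems(2) m(1) cv(1) by auto
    ultimately show "\<phi> v \<in> set (labels c)" "\<phi> v \<noteq> l" using m(1) by simp_all
  qed
  have "filter (\<lambda>v. \<phi> v \<noteq> l) (labels (subst (Node l cs) F)) =
      concat (map labels (map (\<lambda>c. subst c F) cs))"
  proof (rule filter_labels_grafts(1)[OF g])
    show "\<forall>x\<in>set (labels (F l)). \<not> \<phi> x \<noteq> l" using Node.prems(3) by simp
    show "\<forall>a\<in>set (map (\<lambda>c. subst c F) cs). \<forall>x\<in>set (labels a). \<phi> x \<noteq> l" using sub(2) by auto
  qed
  then have fil: "filter (\<lambda>v. \<phi> v \<noteq> l) (concat (map labels ss)) =
      concat (map (\<lambda>c. labels (subst c F)) cs)"
    using x unfolding ss by (simp add: comp_def)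
  have "firsts (map \<phi> (labels (subst (Node l cs) F))) =
      l # firsts (filter (\<lambda>m. m \<noteq> l) (map \<phi> (concat (map labels ss))))"
    unfolding ss using x by (simp add: filter_firsts)
  also have "filter (\<lambda>m. m \<noteq> l) (map \<phi> (concat (map labels ss))) =
      map \<phi> (concat (map (\<lambda>c. labels (subst c F)) cs))"
    using fil by (simp add: filter_map comp_def)
  also have "firsts \<dots> = concat (map labels cs)"
  proof -
    have "\<forall>c\<in>set cs. firsts (map \<phi> (labels (subst c F))) = labels c"
      using Node.IH Node.prems by (auto simp: distinct_concat_iff)
    moreover have "\<forall>c\<in>set cs. \<phi> ` set (labels (subst c F)) \<subseteq> set (labels c)"
      using sub(1) by blast
    moreover have "distinct (concat (map labels cs))" using Node.prems(2) by simp
    ultimately show ?thesis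
    proof (induction cs)
      case (Cons c cs)
      \<comment> \<open>Different subtrees contribute disjoint sets of letters, so
        \<open>firsts\<close> distributes over their concatenation.\<close>
      have "\<phi> ` set (labels (subst c F)) \<inter>
          \<phi> ` (\<Union>c\<in>set cs. set (labels (subst c F))) = {}"
        using Cons.prems(2,3) by fastforce
      then have "firsts (map \<phi> (concat (map (\<lambda>c. labels (subst c F)) (c # cs)))) =
          firsts (map \<phi> (labels (subst c F))) @
          firsts (map \<phi> (concat (map (\<lambda>c. labels (subst c F)) cs)))"
        by (simp add: firsts_append)
      then show ?case using Cons by simp
    qed simp
  qed
  finally show ?case by simp
qed simp

section \<open>The vertex map of a morphism and its word\<close>

definition block :: "nmor \<Rightarrow> nat \<Rightarrow> nat" where
  "block f v = (SOME l. l \<in> {1..nverts (msrc f)} \<and> v \<in> set (labels (family f l)))"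

definition word :: "nmor \<Rightarrow> nat list" where
  "word f = map (block f) (labels (mtgt f))"

lemma distinct_concat_map_eqD:
  "distinct (concat (map f xs)) \<Longrightarrow> a \<in> set xs \<Longrightarrow> b \<in> set xs \<Longrightarrow>
    v \<in> set (f a) \<Longrightarrow> v \<in> set (f b) \<Longrightarrow> a = b"
  by (induction xs) auto

text \<open>The labels of all blocks together form the label list of \<open>q\<close> up to order,
  and that list has no repetition.\<close>

lemma labels_family_disjoint:
  assumes "is_nmor p q f" "l \<in> {1..nverts p}" "v \<in> set (labels (family f l))"
    "l' \<in> {1..nverts p}" "v \<in> set (labels (family f l'))"
  shows "l = l'"
proof -
  note f = is_nmorD[OF assms(1)]
  have "mset (labels q) = mset (concat (map (\<lambda>l. labels (family f l)) (labels p)))"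
    using mset_labels_subst[OF f(5)] f(6) by simp
  then have *: "distinct (concat (map (\<lambda>l. labels (family f l)) (labels p)))"
    using mset_eq_imp_distinct_iff distinct_labels_is_ptree[OF f(2)] by blast
  have "l \<in> set (labels p)" "l' \<in> set (labels p)"
    using assms(2,4) set_labels_is_ptree[OF f(1)] by simp_all
  with * show ?thesis using assms(3,5) by (rule distinct_concat_map_eqD)
qed

lemma block_eq_iff:
  assumes "is_nmor p q f" "v \<in> {1..nverts q}" "l \<in> {1..nverts p}"
  shows "block f v = l \<longleftrightarrow> v \<in> set (labels (family f l))"
proof -
  note f = is_nmorD[OF assms(1)]
  have "\<exists>l. l \<in> {1..nverts p} \<and> v \<in> set (labels (family f l))"
    using set_labels_subst[OF f(5)] f(6) assms(2) set_labels_is_ptree[OF f(1)]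
      set_labels_is_ptree[OF f(2)] by auto
  from someI_ex[OF this] have "block f v \<in> {1..nverts p} \<and> v \<in> set (labels (family f (block f v)))"
    unfolding block_def f(3) .
  then show ?thesis using labels_family_disjoint[OF assms(1)] assms(3) by blast
qed

text \<open>The list depends on the source alone: the word of any morphism out of a tree meets its
  vertices for the first time in the very order along which words of morphisms into that tree are
  written.\<close>

lemma firsts_word:
  assumes "is_nmor p q f"
  shows "firsts (word f) = labels p"
proof -
  note f = is_nmorD[OF assms]
  have "\<forall>l\<in>set (labels p). \<forall>v\<in>set (labels (family f l)). block f v = l"
    using block_eq_iff[OF assms] set_labels_family_subset[OF assms] set_labels_is_ptree[OF f(1)] by blast
  from firsts_labels_subst[OF f(5) distinct_labels_is_ptree[OF f(1)] this]
  show ?thesis unfolding word_def f(4,6) .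
qed

text \<open>Vertex maps compose: a vertex of \<open>r\<close> in block \<open>j\<close> of
  \<open>g\<close> goes to the block of \<open>f\<close> that contains \<open>j\<close>.\<close>

lemma word_ncomp:
  assumes "is_nmor p q f" "is_nmor q r g"
  shows "word (ncomp g f) = map (block f) (word g)"
proof -
  note f = is_nmorD[OF assms(1)] and g = is_nmorD[OF assms(2)]
  note gf = is_nmor_ncomp[OF assms]
  have "block (ncomp g f) v = block f (block g v)" if v: "v \<in> set (labels r)" for v
  proof -
    have v': "v \<in> {1..nverts r}" using v set_labels_is_ptree[OF g(2)] by simp
    obtain j where j: "j \<in> {1..nverts q}" "v \<in> set (labels (family g j))"
      using set_labels_subst[OF g(5)] g(6) v set_labels_is_ptree[OF g(1)] by auto
    obtain l where l: "l \<in> {1..nverts p}" "j \<in> set (labels (family f l))"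
      using set_labels_subst[OF f(5)] f(6) j(1) set_labels_is_ptree[OF f(1)]
        set_labels_is_ptree[OF f(2)] by auto
    have "family_ok (family f l) (family g)"
      using family_ok_subst_iff[OF f(5), of "family g"] f(6) g(5) l set_labels_is_ptree[OF f(1)] by simp
    then have "v \<in> set (labels (family (ncomp g f) l))"
      using set_labels_subst[of "family f l" "family g"] family_ncomp[OF assms l(1)] l(2) j(2) by auto
    then have "block (ncomp g f) v = l" using block_eq_iff[OF gf v' l(1)] by simp
    moreover have "block g v = j" using block_eq_iff[OF assms(2) v' j(1)] j(2) by simp
    moreover have "block f j = l" using block_eq_iff[OF assms(1) j(1) l(1)] l(2) by simp
    ultimately show ?thesis by simp
  qed
  then show ?thesis unfolding word_def g(4) is_nmorD(4)[OF gf] by simp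
qed

text \<open>The word fixes the label set of each block, and with prescribed label sets
  \<open>subst_inject\<close> recovers the trees.\<close>

lemma word_inject:
  assumes "is_nmor p q f" "is_nmor p q g" "word f = word g"
  shows "f = g"
proof (rule nmor_eqI[OF assms(1,2)])
  fix l assume l: "l \<in> {1..nverts p}"
  note f = is_nmorD[OF assms(1)] and g = is_nmorD[OF assms(2)]
  have "map (block f) (labels q) = map (block g) (labels q)"
    using assms(3) unfolding word_def f(4) g(4) .
  then have blk: "block f v = block g v" if "v \<in> {1..nverts q}" for v
    using that unfolding map_eq_conv set_labels_is_ptree[OF f(2)] by blast
  have "set (labels (family f l)) = set (labels (family g l))" if "l \<in> {1..nverts p}" for l
  proof (intro set_eqI)
    fix v
    show "v \<in> set (labels (family f l)) \<longleftrightarrow> v \<in> set (labels (family g l))"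
    proof (cases "v \<in> {1..nverts q}")
      case True
      then show ?thesis
        using block_eq_iff[OF assms(1) True that] block_eq_iff[OF assms(2) True that] blk by simp
    next
      case False
      then show ?thesis using set_labels_family_subset[OF assms(1) that]
          set_labels_family_subset[OF assms(2) that] by blast
    qed
  qed
  then show "family f l = family g l"
    using subst_inject[OF f(5) g(5), of l] f(6) g(6) l distinct_labels_is_ptree[OF f(2)]
      set_labels_is_ptree[OF f(1)] by simp
qed

lemma admissible_order_nupOp_op: "\<exists>R. admissible_order nupOp_op p R"
proof
  \<comment> \<open>Words of morphisms into a fixed \<open>q\<close> have equal length, so on them
    \<open>lenlex\<close> is the lexicographic order; it is well-founded on all words.\<close>
  define R where "R q = {(f, g). is_nmor p q f \<and> is_nmor p q g \<and>
    (f = g \<or> (word f, word g) \<in> lenlex less_than)}" for q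
  have irr: "(xs, xs) \<notin> lenlex less_than" for xs :: "nat list"
    by (rule lenlex_irreflexive) simp
  have tot: "total (lenlex less_than)" by (rule total_lenlex) auto
  have tr: "trans (lenlex less_than)" by (intro lenlex_transI trans_less_than)
  have "well_order_on {f. is_nmor p q f} (R q)" for q
    unfolding well_order_on_def linear_order_on_def partial_order_on_def preorder_on_def
  proof (intro conjI)
    show "R q \<subseteq> {f. is_nmor p q f} \<times> {f. is_nmor p q f}" by (auto simp: R_def)
    show "refl_on {f. is_nmor p q f} (R q)" by (auto simp: R_def refl_on_def)
    show "trans (R q)" using transD[OF tr] by (auto simp: R_def intro!: transI)
    show "antisym (R q)" using transD[OF tr] irr by (auto simp: R_def intro!: antisymI)
    show "total_on {f. is_nmor p q f} (R q)"
    proof (rule total_onI)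
      fix f g assume "f \<in> {f. is_nmor p q f}" "g \<in> {f. is_nmor p q f}" "f \<noteq> g"
      then have "is_nmor p q f" "is_nmor p q g" "word f \<noteq> word g" using word_inject by auto
      then show "(f, g) \<in> R q \<or> (g, f) \<in> R q"
        using tot by (auto simp: R_def total_on_def)
    qed
    have "wf (inv_image (lenlex less_than) word)" by auto
    then show "wf (R q - Id)" by (rule wf_subset) (auto simp: R_def)
  qed
  moreover have "(ncomp g f, ncomp g f') \<in> R r \<and> ncomp g f \<noteq> ncomp g f'"
    if "is_nmor p q f" "is_nmor p q f'" "is_nmor q r g" "(f, f') \<in> R q" "f \<noteq> f'" for q r f f' g
  proof -
    have "(word f, word f') \<in> lenlex less_than" using that by (auto simp: R_def)
    \<comment> \<open>\<open>word f\<close> is written along the preorder of \<open>q\<close>, which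
      is the list of first occurrences in \<open>word g\<close>.\<close>
    then have "(map (block f) (firsts (word g)), map (block f') (firsts (word g))) \<in> lenlex less_than"
      unfolding firsts_word[OF that(3)] unfolding word_def is_nmorD(4)[OF that(1)] is_nmorD(4)[OF that(2)] .
    then have "(word (ncomp g f), word (ncomp g f')) \<in> lenlex less_than"
      unfolding word_ncomp[OF that(1,3)] word_ncomp[OF that(2,3)] by (rule lenlex_firsts)
    then show ?thesis
      using is_nmor_ncomp[OF that(1,3)] is_nmor_ncomp[OF that(2,3)] irr by (auto simp: R_def)
  qed
  ultimately show "admissible_order nupOp_op p R"
    unfolding admissible_order_def nupOp_op_def by auto
qed

section \<open>Kruskal's tree theorem and contractions\<close>

definition good_on :: "('a \<Rightarrow> 'a \<Rightarrow> bool) \<Rightarrow> 'a set \<Rightarrow> bool" where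
  "good_on P A \<longleftrightarrow> (\<forall>x :: nat \<Rightarrow> 'a. (\<forall>i. x i \<in> A) \<longrightarrow> (\<exists>i j. i < j \<and> P (x i) (x j)))"

lemma good_onD:
  assumes "good_on P A" "\<And>i. x i \<in> A"
  obtains i j :: nat where "i < j" "P (x i) (x j)"
  using assms unfolding good_on_def by metis

text \<open>Ramsey's theorem on pairs of indices: the homogeneous set has the good colour, because
  goodness supplies at least one good pair inside it.\<close>

lemma good_on_chain:
  assumes "good_on P A" "\<And>i::nat. x i \<in> A"
  obtains \<sigma> :: "nat \<Rightarrow> nat" where "strict_mono \<sigma>" "\<And>i j. i < j \<Longrightarrow> P (x (\<sigma> i)) (x (\<sigma> j))"
proof -
  \<comment> \<open>\<open>Min\<close> and \<open>Max\<close> recover the order of the indices from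
    the unordered pair being coloured.\<close>
  define f where "f X = (if P (x (Min X)) (x (Max X)) then 0 else (1::nat))" for X :: "nat set"
  have "\<forall>i\<in>UNIV. \<forall>j\<in>UNIV. i \<noteq> j \<longrightarrow> f {i, j} < 2" by (simp add: f_def)
  from Ramsey2[OF infinite_UNIV_nat this]
  obtain Y t where Y: "infinite Y" "\<forall>i\<in>Y. \<forall>j\<in>Y. i \<noteq> j \<longrightarrow> f {i, j} = t" by blast
  let ?\<sigma> = "enumerate Y"
  have \<sigma>: "strict_mono ?\<sigma>" "?\<sigma> i \<in> Y" for i
    using Y(1) by (auto simp: strict_mono_enumerate enumerate_in_set)
  have f: "f {?\<sigma> i, ?\<sigma> j} = (if P (x (?\<sigma> i)) (x (?\<sigma> j)) then 0 else 1)" if "i < j" for i j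
    using strict_monoD[OF \<sigma>(1) that] by (simp add: f_def min_def max_def)
  have t: "f {?\<sigma> i, ?\<sigma> j} = t" if "i < j" for i j
    using strict_monoD[OF \<sigma>(1) that] Y(2) \<sigma>(2) by (metis less_irrefl)
  obtain i j where "i < j" "P (x (?\<sigma> i)) (x (?\<sigma> j))"
    using good_onD[OF assms(1), of "\<lambda>i. x (?\<sigma> i)"] assms(2) by blast
  then have "t = 0" using f t by metis
  then have "P (x (?\<sigma> i)) (x (?\<sigma> j))" if "i < j" for i j
    using f[OF that] t[OF that] by (auto split: if_splits)
  with \<sigma>(1) that show ?thesis by blast
qed

lemma good_on_finite:
  assumes "finite A" "\<And>a. a \<in> A \<Longrightarrow> P a a"
  shows "good_on P A"
  unfolding good_on_def
proof (intro allI impI)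
  fix x :: "nat \<Rightarrow> 'a" assume x: "\<forall>i. x i \<in> A"
  then have "finite (range x)" using assms(1) by (meson finite_subset image_subsetI)
  then have "\<not> inj x" using finite_imageD infinite_UNIV_nat by blast
  then obtain i j where "i < j" "x i = x j" by (metis injI linorder_neqE_nat)
  then show "\<exists>i j. i < j \<and> P (x i) (x j)" using assms(2) x by metis
qed

text \<open>Pass to a subsequence all of whose pairs are good for \<open>P\<close>, then find a pair
  good for \<open>Q\<close> in it.\<close>

lemma good_on_conj:
  fixes u :: "'c \<Rightarrow> 'a" and v :: "'c \<Rightarrow> 'b"
  assumes "good_on P (u ` A)" "good_on Q (v ` A)"
  shows "good_on (\<lambda>a b. P (u a) (u b) \<and> Q (v a) (v b)) A"
  unfolding good_on_def
proof (intro allI impI)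
  fix x :: "nat \<Rightarrow> 'c" assume x: "\<forall>i. x i \<in> A"
  obtain \<sigma> :: "nat \<Rightarrow> nat" where \<sigma>: "strict_mono \<sigma>" "\<And>i j. i < j \<Longrightarrow> P (u (x (\<sigma> i))) (u (x (\<sigma> j)))"
    by (rule good_on_chain[OF assms(1), of "\<lambda>i. u (x i)"]) (use x in auto)
  obtain i j :: nat where "i < j" "Q (v (x (\<sigma> i))) (v (x (\<sigma> j)))"
    by (rule good_onD[OF assms(2), of "\<lambda>i. v (x (\<sigma> i))"]) (use x in auto)
  then show "\<exists>i j. i < j \<and> P (u (x i)) (u (x j)) \<and> Q (v (x i)) (v (x j))"
    using \<sigma> strict_monoD by blast
qed

lemma good_on_ball:
  assumes "finite I" "\<And>i. i \<in> I \<Longrightarrow> good_on (P i) A"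
  shows "good_on (\<lambda>a b. \<forall>i\<in>I. P i a b) A"
  using assms
proof (induction I rule: finite_induct)
  case empty
  then show ?case by (auto simp: good_on_def)
next
  case (insert i I)
  then show ?case using good_on_conj[of "P i" id A "\<lambda>a b. \<forall>i\<in>I. P i a b" id] by simp
qed

text \<open>The choice of Nash-Williams: terms are fixed one after another, each of least size among
  the bad sequences that continue the terms already fixed.\<close>

lemma minimal_bad_sequence:
  fixes size :: "'a \<Rightarrow> nat"
  assumes "\<not> good_on P A"
  shows "\<exists>m :: nat \<Rightarrow> 'a. (\<forall>i. m i \<in> A) \<and> (\<forall>i j. i < j \<longrightarrow> \<not> P (m i) (m j)) \<and>
    (\<forall>n h. (\<forall>i. h i \<in> A) \<and> (\<forall>i j. i < j \<longrightarrow> \<not> P (h i) (h j)) \<and> (\<forall>k<n. h k = m k)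
      \<longrightarrow> size (m n) \<le> size (h n))"
proof -
  define bad where "bad h \<longleftrightarrow> (\<forall>i. h i \<in> A) \<and> (\<forall>i j. i < j \<longrightarrow> \<not> P (h i) (h j))"
    for h :: "nat \<Rightarrow> 'a"
  define step where "step n g g' \<longleftrightarrow> (\<forall>k<n. g' k = g k) \<and>
    (\<forall>h. bad h \<and> (\<forall>k<n. h k = g k) \<longrightarrow> size (g' n) \<le> size (h n))" for n and g g' :: "nat \<Rightarrow> 'a"
  obtain g0 where "bad g0" using assms unfolding good_on_def bad_def by blast
  moreover have "\<exists>g'. bad g' \<and> step n g g'" if "bad g" for g n
  proof -
    let ?Q = "\<lambda>h. bad h \<and> (\<forall>k<n. h k = g k)"
    have "?Q (arg_min (\<lambda>h. size (h n)) ?Q) \<and>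
        (\<forall>h. ?Q h \<longrightarrow> size (arg_min (\<lambda>h. size (h n)) ?Q n) \<le> size (h n))"
      by (rule arg_min_nat_lemma[of ?Q g]) (use that in simp)
    then show ?thesis unfolding step_def by blast
  qed
  ultimately obtain G where G: "\<And>n. bad (G n)" "\<And>n. step n (G n) (G (Suc n))"
    using dependent_nat_choice[of "\<lambda>_. bad" step] by blast
  \<comment> \<open>Entry \<open>n\<close> no longer changes after stage \<open>Suc n\<close>, so
    any two entries of the diagonal occur together in one bad stage.\<close>
  define m where "m n = G (Suc n) n" for n
  have agree: "G (Suc k + d) k = m k" for k d
    by (induction d) (use G(2) in \<open>auto simp: m_def step_def\<close>)
  have agree: "G j k = m k" if "k < j" for j k
    using agree[of k "j - Suc k"] that by simp
  show ?thesis
  proof (intro exI[of _ m] conjI allI impI)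
    show "m i \<in> A" for i using G(1) by (simp add: m_def bad_def)
    show "\<not> P (m i) (m j)" if "i < j" for i j
    proof -
      have "G (Suc j) i = m i" "G (Suc j) j = m j" using agree that by auto
      moreover have "\<not> P (G (Suc j) i) (G (Suc j) j)" using G(1) that unfolding bad_def by blast
      ultimately show ?thesis by simp
    qed
    fix n h
    assume h: "(\<forall>i. h i \<in> A) \<and> (\<forall>i j. i < j \<longrightarrow> \<not> P (h i) (h j)) \<and> (\<forall>k<n. h k = m k)"
    then have "bad h" "\<forall>k<n. h k = G n k" using agree by (auto simp: bad_def)
    then show "size (m n) \<le> size (h n)" using G(2)[of n] unfolding step_def m_def by blast
  qed
qed

text \<open>Homeomorphic embedding of the binary trees in the first-child/next-sibling view:
  \<open>child\<close> and \<open>tail\<close> descend into the two immediate subtrees. Vertex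
  labels are ignored, and leaves match only leaves.\<close>

inductive emb :: "ptree list \<Rightarrow> ptree list \<Rightarrow> bool" where
  Nil: "emb [] G"
| Leaf: "emb F G \<Longrightarrow> emb (Leaf # F) (Leaf # G)"
| Node: "emb cs ds \<Longrightarrow> emb F G \<Longrightarrow> emb (Node a cs # F) (Node b ds # G)"
| child: "emb F ds \<Longrightarrow> emb F (Node b ds # G)"
| tail: "emb F G \<Longrightarrow> emb F (d # G)"

text \<open>Nothing lies below a leading leaf; falling back to \<open>tl\<close> there keeps
  \<open>lower F\<close> a smaller forest along which embeddings lift.\<close>

fun lower :: "ptree list \<Rightarrow> ptree list" where
  "lower (Node a cs # F) = cs"
| "lower F = tl F"

lemma emb_lower: "emb F (lower G) \<Longrightarrow> emb F G"
  by (cases G rule: lower.cases) (auto intro: emb.intros)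

lemma emb_tl: "emb F (tl G) \<Longrightarrow> emb F G"
  by (cases G) (auto intro: emb.intros)

lemma emb_lower_tl:
  assumes "F \<noteq> []" "G \<noteq> []" "hd F = Leaf \<longleftrightarrow> hd G = Leaf" "emb (lower F) (lower G)" "emb (tl F) (tl G)"
  shows "emb F G"
  using assms by (cases F rule: lower.cases; cases G rule: lower.cases) (auto intro: emb.intros)

lemma size_lower: "F \<noteq> [] \<Longrightarrow> size_list size (lower F) < size_list size F"
  by (cases F rule: lower.cases) auto

lemma size_tl: "F \<noteq> [] \<Longrightarrow> size_list size (tl F) < size_list size F"
  by (cases F) auto

text \<open>Kruskal's tree theorem. In the first-child/next-sibling view an ordered forest is a binary
  tree, with \<^const>\<open>lower\<close> and \<^const>\<open>tl\<close> as its two immediate subtrees, so that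
  the Nash-Williams argument needs no appeal to Higman's lemma.\<close>

theorem good_on_emb: "good_on emb UNIV"
proof (rule ccontr)
  let ?w = "size_list size :: ptree list \<Rightarrow> nat"
  assume "\<not> good_on emb UNIV"
  from minimal_bad_sequence[OF this, of ?w]
  obtain m :: "nat \<Rightarrow> ptree list" where m: "(\<forall>i. m i \<in> UNIV) \<and> (\<forall>i j. i < j \<longrightarrow> \<not> emb (m i) (m j)) \<and>
    (\<forall>n h. (\<forall>i. h i \<in> UNIV) \<and> (\<forall>i j. i < j \<longrightarrow> \<not> emb (h i) (h j)) \<and> (\<forall>k<n. h k = m k)
      \<longrightarrow> ?w (m n) \<le> ?w (h n))" ..
  have bad: "\<not> emb (m i) (m j)" if "i < j" for i j
    using m that by simp
  have min: "?w (m n) \<le> ?w (h n)"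
    if "\<forall>i j. i < j \<longrightarrow> \<not> emb (h i) (h j)" "\<forall>k<n. h k = m k" for n h
    using m that by simp
  have ne: "m i \<noteq> []" for i using bad[of i "Suc i"] by (auto intro: emb.Nil)
  let ?B = "range (\<lambda>i. lower (m i)) \<union> range (\<lambda>i. tl (m i))"
  have "good_on emb ?B"
    unfolding good_on_def
  proof (intro allI impI, rule ccontr)
    fix y :: "nat \<Rightarrow> ptree list"
    assume y: "\<forall>i. y i \<in> ?B" and "\<nexists>i j. i < j \<and> emb (y i) (y j)"
    then have ybad: "\<And>i j. i < j \<Longrightarrow> \<not> emb (y i) (y j)" by blast
    have "\<forall>k. \<exists>i. y k = lower (m i) \<or> y k = tl (m i)" using y by blast
    then obtain \<tau> where \<tau>: "\<And>k. y k = lower (m (\<tau> k)) \<or> y k = tl (m (\<tau> k))" by metis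
    \<comment> \<open>Selects a term of \<open>y\<close> taken from the earliest possible member of
      \<open>m\<close>.\<close>
    define k0 where "k0 = arg_min \<tau> (\<lambda>_. True)"
    have k0: "\<tau> k0 \<le> \<tau> k" for k
      unfolding k0_def by (rule arg_min_nat_le) simp
    \<comment> \<open>The minimal sequence is continued by \<open>y\<close> from \<open>k0\<close>
      on. This is again bad, yet its entry at \<open>\<tau> k0\<close> is an immediate subforest of
      \<open>m (\<tau> k0)\<close>.\<close>
    define h where "h i = (if i < \<tau> k0 then m i else y (k0 + (i - \<tau> k0)))" for i
    \<comment> \<open>Such an embedding would lift to \<open>m (\<tau> k)\<close>, although
      \<open>i < \<tau> k0 \<le> \<tau> k\<close>.\<close>
    have my: "\<not> emb (m i) (y k)" if "i < \<tau> k0" for i k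
      using bad[of i "\<tau> k"] \<tau>[of k] that k0[of k] emb_lower emb_tl by (metis order.strict_trans2)
    have "?w (m (\<tau> k0)) \<le> ?w (h (\<tau> k0))"
    proof (rule min)
      show "\<forall>i j. i < j \<longrightarrow> \<not> emb (h i) (h j)"
        using bad my ybad by (simp add: h_def)
    qed (simp_all add: h_def)
    also have "\<dots> < ?w (m (\<tau> k0))"
      using \<tau>[of k0] size_lower[OF ne] size_tl[OF ne] by (auto simp: h_def)
    finally show False by simp
  qed
  then have "good_on emb (lower ` range m)" "good_on emb (tl ` range m)"
    by (auto simp: good_on_def image_image)
  \<comment> \<open>Whether a forest starts with a leaf is a third, two-valued component; agreement
    there and embeddings of both subforests lift by \<open>emb_lower_tl\<close>.\<close>
  moreover have "good_on (=) ((\<lambda>F. hd F = Leaf) ` range m)" by (rule good_on_finite) auto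
  moreover from calculation(1,2)
  have "good_on (\<lambda>F G. emb (lower F) (lower G) \<and> emb (tl F) (tl G)) (id ` range m)"
    using good_on_conj[of emb lower "range m" emb tl] by simp
  ultimately have "good_on (\<lambda>F G. (hd F = Leaf) = (hd G = Leaf) \<and>
      emb (lower (id F)) (lower (id G)) \<and> emb (tl (id F)) (tl (id G))) (range m)"
    by (intro good_on_conj[where v=id]) simp_all
  then have "good_on (\<lambda>F G. (hd F = Leaf) = (hd G = Leaf) \<and>
      emb (lower F) (lower G) \<and> emb (tl F) (tl G)) (range m)" by simp
  then obtain i j :: nat where "i < j" "(hd (m i) = Leaf) = (hd (m j) = Leaf)"
      "emb (lower (m i)) (lower (m j))" "emb (tl (m i)) (tl (m j))"
    by (rule good_onD[of _ _ m]) auto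
  with emb_lower_tl ne bad show False by metis
qed

text \<open>Leaves go to leaves. When the totals agree, every skipped sibling is thus leafless and
  can be absorbed in a contraction.\<close>

lemma nleaves_emb: "emb F G \<Longrightarrow> sum_list (map nleaves F) \<le> sum_list (map nleaves G)"
  by (induction rule: emb.induct) auto

lemma graftsl_leafless:
  assumes "sum_list (map nleaves G) = 0"
  shows "graftsl G [] G"
  using grafts_Leaves(2)[of G] unfolding assms by simp

text \<open>The vertices of \<^term>\<open>Node y G\<close> missed by the embedding are contracted into their closest
  ancestor in its image, or into the root.\<close>

lemma emb_imp_subst:
  "emb F G \<Longrightarrow> sum_list (map nleaves F) = sum_list (map nleaves G) \<Longrightarrow>
    distinct (x # concat (map labels F)) \<Longrightarrow>
    \<exists>H. family_ok (Node x F) H \<and> subst (Node x F) H = Node y G"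
proof -
  \<comment> \<open>A forest has no root to absorb missed vertices: \<open>U\<close> collects those
    with no ancestor in the image, with leaves where the expanded trees are attached.\<close>
  have main: "emb F G \<Longrightarrow> sum_list (map nleaves F) = sum_list (map nleaves G) \<Longrightarrow>
    distinct (concat (map labels F)) \<Longrightarrow>
    \<exists>H U. (\<forall>c\<in>set F. family_ok c H) \<and> graftsl U (map (\<lambda>c. subst c H) F) G" for F G
  proof (induction rule: emb.induct)
    case (Nil G)
    then show ?case using graftsl_leafless[of G] by auto
  next
    case (Leaf F G)
    then obtain H U where "\<forall>c\<in>set F. family_ok c H" "graftsl U (map (\<lambda>c. subst c H) F) G" by auto
    then show ?case using grafts_graftsl.Cons[OF grafts_graftsl.Leaf[of Leaf]]
      by (intro exI[of _ H] exI[of _ "ptree.Leaf # U"]) auto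
  next
    case (Node cs ds F G a b)
    have eq: "sum_list (map nleaves cs) = sum_list (map nleaves ds)"
        "sum_list (map nleaves F) = sum_list (map nleaves G)"
      using Node.prems(1) nleaves_emb[OF Node.hyps(1)] nleaves_emb[OF Node.hyps(2)] by simp_all
    obtain H U where H: "\<forall>c\<in>set cs. family_ok c H" "graftsl U (map (\<lambda>c. subst c H) cs) ds"
      using Node.IH(1)[OF eq(1)] Node.prems(2) by auto
    obtain H' U' where H': "\<forall>c\<in>set F. family_ok c H'" "graftsl U' (map (\<lambda>c. subst c H') F) G"
      using Node.IH(2)[OF eq(2)] Node.prems(2) by auto
    \<comment> \<open>The matched vertex \<open>a\<close> expands to \<open>Node b U\<close>,
      absorbing what was missed below \<open>b\<close>; the families on \<open>cs\<close> and
      \<open>F\<close> glue since their labels are disjoint.\<close>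
    define K where "K l = (if l = a then ptree.Node b U else if l \<in> set (concat (map labels cs)) then H l else H' l)" for l
    have 1: "K l = H l" if "c \<in> set cs" "l \<in> set (labels c)" for c l
      using that Node.prems(2) by (auto simp: K_def)
    have 2: "K l = H' l" if "c \<in> set F" "l \<in> set (labels c)" for c l
      using that Node.prems(2) by (auto simp: K_def)
    have s1: "map (\<lambda>c. subst c K) cs = map (\<lambda>c. subst c H) cs"
      using 1 by (auto intro!: subst_cong)
    have s2: "map (\<lambda>c. subst c K) F = map (\<lambda>c. subst c H') F"
      using 2 by (auto intro!: subst_cong)
    have len: "nleaves (ptree.Node b U) = length cs" using length_grafts(2)[OF H(2)] by simp
    have "grafts (K a) (map (\<lambda>c. subst c K) cs) (ptree.Node b ds)"
      using grafts_graftsl.Node[OF H(2)] unfolding s1 by (simp add: K_def)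
    then have sub: "subst (ptree.Node a cs) K = ptree.Node b ds" using fst_graft_if_grafts by simp
    have "graftsl (ptree.Leaf # U') (map (\<lambda>c. subst c K) (ptree.Node a cs # F)) (ptree.Node b ds # G)"
      using grafts_graftsl.Cons[OF grafts_graftsl.Leaf[of "ptree.Node b ds"] H'(2)]
      unfolding list.map s2 sub by simp
    moreover have "family_ok c K" if "c \<in> set cs" for c
      using family_ok_cong[of c K H] 1 that H(1) by blast
    moreover have "family_ok c K" if "c \<in> set F" for c
      using family_ok_cong[of c K H'] 2 that H'(1) by blast
    moreover have "K a \<noteq> ptree.Leaf" "nleaves (K a) = length cs" using len by (auto simp: K_def)
    ultimately show ?case by (intro exI[of _ K] exI[of _ "ptree.Leaf # U'"]) simp
  next
    case (child F ds b G)
    then have eq: "sum_list (map nleaves F) = sum_list (map nleaves ds)" "sum_list (map nleaves G) = 0"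
      using nleaves_emb[OF child.hyps] by simp_all
    obtain H U where H: "\<forall>c\<in>set F. family_ok c H" "graftsl U (map (\<lambda>c. subst c H) F) ds"
      using child.IH[OF eq(1) child.prems(2)] by auto
    \<comment> \<open>The missed vertex \<open>b\<close> joins the contracted part; its siblings
      \<open>G\<close> are leafless by the count and join it whole.\<close>
    then show ?case
      using grafts_graftsl.Cons[OF grafts_graftsl.Node[OF H(2)] graftsl_leafless[OF eq(2)]]
      by (intro exI[of _ H] exI[of _ "ptree.Node b U # G"]) simp
  next
    case (tail F G d)
    then have eq: "sum_list (map nleaves F) = sum_list (map nleaves G)" "nleaves d = 0"
      using nleaves_emb[OF tail.hyps] by simp_all
    obtain H U where H: "\<forall>c\<in>set F. family_ok c H" "graftsl U (map (\<lambda>c. subst c H) F) G"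
      using tail.IH[OF eq(1) tail.prems(2)] by auto
    have "grafts d [] d" using grafts_Leaves(1)[of d] eq(2) by simp
    then show ?case using grafts_graftsl.Cons H
      by (intro exI[of _ H] exI[of _ "d # U"]) fastforce
  qed
  assume "emb F G" "sum_list (map nleaves F) = sum_list (map nleaves G)"
    and dist: "distinct (x # concat (map labels F))"
  then obtain H U where H: "\<forall>c\<in>set F. family_ok c H" "graftsl U (map (\<lambda>c. subst c H) F) G"
    using main[of F G] by auto
  \<comment> \<open>The root absorbs the missed vertices that have no ancestor in the image.\<close>
  let ?K = "H(x := Node y U)"
  have K: "subst c ?K = subst c H" "family_ok c ?K" if "c \<in> set F" for c
  proof -
    have "?K l = H l" if "l \<in> set (labels c)" for l
      using dist that \<open>c \<in> set F\<close> by auto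
    then show "subst c ?K = subst c H" "family_ok c ?K"
      using subst_cong[of c ?K H] family_ok_cong[of c ?K H] that H(1) by blast+
  qed
  have eq: "map (\<lambda>c. subst c ?K) F = map (\<lambda>c. subst c H) F" using K(1) by simp
  have "grafts (?K x) (map (\<lambda>c. subst c ?K) F) (Node y G)"
    unfolding eq using grafts_graftsl.Node[OF H(2), of y] by simp
  from fst_graft_if_grafts[OF this] have "subst (Node x F) ?K = Node y G"
    unfolding subst.simps .
  moreover have "family_ok (Node x F) ?K" using K(2) length_grafts(2)[OF H(2)] by simp
  ultimately show ?thesis by blast
qed

section \<open>Transport along injections\<close>

text \<open>The isomorphic copy of \<open>D\<close> on codes, with \<open>inv\<close> as decoding;
  the witness in \<open>quasi_groebner\<close> has to live on \<open>nat\<close>.\<close>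

definition image_category ::
  "('o \<Rightarrow> 'p) \<Rightarrow> ('m \<Rightarrow> 'n) \<Rightarrow> ('o, 'm) category \<Rightarrow> ('p, 'n) category" where
  "image_category e d D = \<lparr> Ob = e ` Ob D,
     Hom = (\<lambda>a b. d ` Hom D (inv e a) (inv e b)),
     Cmp = (\<lambda>g f. d (Cmp D (inv d g) (inv d f))),
     Idm = (\<lambda>a. d (Idm D (inv e a))) \<rparr>"

lemma is_categoryD:
  assumes "is_category D"
  shows "\<lbrakk>a \<in> Ob D; b \<in> Ob D; a' \<in> Ob D; b' \<in> Ob D; (a, b) \<noteq> (a', b')\<rbrakk> \<Longrightarrow> Hom D a b \<inter> Hom D a' b' = {}"
    and "a \<in> Ob D \<Longrightarrow> Idm D a \<in> Hom D a a"
    and "\<lbrakk>a \<in> Ob D; b \<in> Ob D; c \<in> Ob D; f \<in> Hom D a b; g \<in> Hom D b c\<rbrakk> \<Longrightarrow> Cmp D g f \<in> Hom D a c"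
    and "\<lbrakk>a \<in> Ob D; b \<in> Ob D; c \<in> Ob D; z \<in> Ob D; f \<in> Hom D a b; g \<in> Hom D b c; h \<in> Hom D c z\<rbrakk>
      \<Longrightarrow> Cmp D h (Cmp D g f) = Cmp D (Cmp D h g) f"
    and "\<lbrakk>a \<in> Ob D; b \<in> Ob D; f \<in> Hom D a b\<rbrakk> \<Longrightarrow> Cmp D (Idm D b) f = f"
    and "\<lbrakk>a \<in> Ob D; b \<in> Ob D; f \<in> Hom D a b\<rbrakk> \<Longrightarrow> Cmp D f (Idm D a) = f"
proof -
  note c = assms[unfolded is_category_def]
  note c2 = c[THEN conjunct2] note c3 = c2[THEN conjunct2] note c4 = c3[THEN conjunct2]
  show "\<lbrakk>a \<in> Ob D; b \<in> Ob D; a' \<in> Ob D; b' \<in> Ob D; (a, b) \<noteq> (a', b')\<rbrakk> \<Longrightarrow> Hom D a b \<inter> Hom D a' b' = {}"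
    by (rule c[THEN conjunct1, rule_format]) simp
  show "a \<in> Ob D \<Longrightarrow> Idm D a \<in> Hom D a a"
    by (rule c2[THEN conjunct1, rule_format])
  show "\<lbrakk>a \<in> Ob D; b \<in> Ob D; c \<in> Ob D; f \<in> Hom D a b; g \<in> Hom D b c\<rbrakk> \<Longrightarrow> Cmp D g f \<in> Hom D a c"
    by (rule c3[THEN conjunct1, rule_format, of a b]) simp
  show "\<lbrakk>a \<in> Ob D; b \<in> Ob D; c \<in> Ob D; z \<in> Ob D; f \<in> Hom D a b; g \<in> Hom D b c; h \<in> Hom D c z\<rbrakk>
      \<Longrightarrow> Cmp D h (Cmp D g f) = Cmp D (Cmp D h g) f"
    by (rule c4[THEN conjunct1, rule_format, of a b c z]) simp
  show "\<lbrakk>a \<in> Ob D; b \<in> Ob D; f \<in> Hom D a b\<rbrakk> \<Longrightarrow> Cmp D (Idm D b) f = f"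
    "\<lbrakk>a \<in> Ob D; b \<in> Ob D; f \<in> Hom D a b\<rbrakk> \<Longrightarrow> Cmp D f (Idm D a) = f"
    using c4[THEN conjunct2, rule_format, of a b f] by simp_all
qed

lemma is_category_image_category:
  assumes "is_category D" "inj e" "inj d"
  shows "is_category (image_category e d D)"
proof -
  note D = is_categoryD[OF assms(1)]
  let ?C = "image_category e d D"
  have C: "Ob ?C = e ` Ob D" "Hom ?C (e a) (e b) = d ` Hom D a b"
    "Cmp ?C (d g) (d f) = d (Cmp D g f)" "Idm ?C (e a) = d (Idm D a)" for a b f g
    using assms(2,3) by (simp_all add: image_category_def)
  have disj: "d ` Hom D a b \<inter> d ` Hom D a' b' = {}"
    if "a \<in> Ob D" "b \<in> Ob D" "a' \<in> Ob D" "b' \<in> Ob D" "(e a, e b) \<noteq> (e a', e b')" for a b a' b'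
    unfolding image_Int[OF assms(3), symmetric] using D(1)[OF that(1-4)] that(5) by auto
  show ?thesis
    unfolding is_category_def C
  proof (intro conjI allI impI; (elim conjE imageE)?)
  qed (auto simp: C disj intro: D intro!: arg_cong[of _ _ d] D(4-6))
qed

text \<open>Decoding is an isomorphism from the coded copy onto \<open>D\<close>, so essential
  surjectivity and (F) are both witnessed by identity morphisms.\<close>

lemma quasi_groebner_if_groebner:
  fixes D :: "('o, 'm) category" and e :: "'o \<Rightarrow> nat" and d :: "'m \<Rightarrow> nat"
  assumes D: "groebner D" and e: "inj e" and d: "inj d"
  shows "quasi_groebner D"
proof -
  let ?C = "image_category e d D"
  have cat: "is_category D" "is_category ?C"
    using D is_category_image_category e d by (auto simp: groebner_def)
  have C: "Ob ?C = e ` Ob D" "Hom ?C (e a) (e b) = d ` Hom D a b"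
    "Cmp ?C (d g) (d f) = d (Cmp D g f)" "Idm ?C (e a) = d (Idm D a)" for a b f g
    using e d by (simp_all add: image_category_def)
  have "groebner ?C"
    unfolding groebner_def
  proof (intro conjI ballI cat)
    fix c assume "c \<in> Ob ?C"
    then obtain a where a: "a \<in> Ob D" "c = e a" by (auto simp: C)
    obtain R where R: "admissible_order D a R" using D a(1) by (auto simp: groebner_def)
    show "\<exists>R. admissible_order ?C c R"
    proof
      define Q where "Q b = dir_image (R (inv e b)) d" for b
      have Q: "Q (e b) = dir_image (R b) d" for b using e by (simp add: Q_def)
      have inR: "(d f, d g) \<in> Q (e b) \<longleftrightarrow> (f, g) \<in> R b" for b f g
        by (auto simp: Q dir_image_def inj_eq[OF d])
      have "well_order_on (d ` Hom D a b) (Q (e b))" if b: "b \<in> Ob D" for b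
      proof -
        have wo: "well_order_on (Hom D a b) (R b)"
          using R b unfolding admissible_order_def by blast
        then have "Hom D a b = Field (R b)" by (rule well_order_on_Field)
        with wo show ?thesis
          using Well_order_dir_image[of "R b" d] d
          by (simp add: Q dir_image_Field inj_on_subset)
      qed
      moreover have "(d (Cmp D g f), d (Cmp D g f')) \<in> Q (e b') \<and> d (Cmp D g f) \<noteq> d (Cmp D g f')"
        if "b \<in> Ob D" "b' \<in> Ob D" "f \<in> Hom D a b" "f' \<in> Hom D a b" "g \<in> Hom D b b'"
          "(d f, d f') \<in> Q (e b)" "d f \<noteq> d f'" for b b' f f' g
        using R that unfolding admissible_order_def inR by (simp add: inj_eq[OF d])
      ultimately show "admissible_order ?C c Q"
        unfolding admissible_order_def a(2) by (auto simp: C)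
    qed
    have "noetherian_under D a" using D a(1) by (auto simp: groebner_def)
    show "noetherian_under ?C c"
      unfolding noetherian_under_def
    proof (intro allI impI)
      fix x :: "nat \<Rightarrow> nat" assume "\<forall>i. x i \<in> out_mor ?C c"
      moreover have "out_mor ?C c = d ` out_mor D a" by (auto simp: out_mor_def C a(2))
      ultimately have "\<forall>i. \<exists>f. f \<in> out_mor D a \<and> x i = d f" by auto
      then obtain y where y: "\<And>i. y i \<in> out_mor D a" "\<And>i. x i = d (y i)" by metis
      then obtain i j where "i < j" "factor_le D a (y i) (y j)"
        using \<open>noetherian_under D a\<close> unfolding noetherian_under_def by blast
      then have "factor_le ?C c (x i) (x j)"
        unfolding factor_le_def y(2) a(2) C by (fastforce simp: C)
      with \<open>i < j\<close> show "\<exists>i j. i < j \<and> factor_le ?C c (x i) (x j)" by blast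
    qed
  qed
  moreover have "is_functor ?C D (inv e) (inv d)"
    unfolding is_functor_def using cat e d by (auto simp: C)
  moreover have "essentially_surjective ?C D (inv e)"
    unfolding essentially_surjective_def
  proof
    fix a assume "a \<in> Ob D"
    then show "\<exists>c\<in>Ob ?C. \<exists>u v. u \<in> Hom D (inv e c) a \<and> v \<in> Hom D a (inv e c) \<and>
        Cmp D v u = Idm D (inv e c) \<and> Cmp D u v = Idm D a"
      using is_categoryD(2,5)[OF cat(1)] e
      by (intro bexI[of _ "e a"] exI[of _ "Idm D a"]) (auto simp: C)
  qed
  moreover have "property_F ?C D (inv e) (inv d)"
    unfolding property_F_def
  proof
    fix a assume a: "a \<in> Ob D"
    show "\<exists>S. finite S \<and> (\<forall>(c, f)\<in>S. c \<in> Ob ?C \<and> f \<in> Hom D a (inv e c)) \<and>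
        (\<forall>c\<in>Ob ?C. \<forall>f\<in>Hom D a (inv e c). \<exists>(c', f')\<in>S. \<exists>g\<in>Hom ?C c' c. f = Cmp D (inv d g) f')"
      \<comment> \<open>One generator, the identity of \<open>a\<close>: each morphism out of
        \<open>a\<close> is the decoding of its own code.\<close>
      by (rule exI[of _ "{(e a, Idm D a)}"]) (use a e d is_categoryD(2,6)[OF cat(1)] in \<open>auto simp: C\<close>)
  qed
  ultimately show ?thesis unfolding quasi_groebner_def by blast
qed

section \<open>The category is Groebner\<close>

lemma distinct_labels_family:
  assumes "is_nmor p q f" "l \<in> {1..nverts p}"
  shows "distinct (labels (family f l))"
proof -
  note f = is_nmorD[OF assms(1)]
  have "mset (labels q) = mset (concat (map (\<lambda>l. labels (family f l)) (labels p)))"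
    using mset_labels_subst[OF f(5)] f(6) by simp
  then have "distinct (concat (map (\<lambda>l. labels (family f l)) (labels p)))"
    using mset_eq_imp_distinct_iff distinct_labels_is_ptree[OF f(2)] by blast
  then show ?thesis
    using assms(2) set_labels_is_ptree[OF f(1)] by (auto simp: distinct_concat_iff)
qed

fun children :: "ptree \<Rightarrow> ptree list" where
  "children Leaf = []"
| "children (Node l cs) = cs"

text \<open>By \<open>emb_imp_subst\<close> each tree of \<open>g\<close> expands the corresponding
  tree of \<open>f\<close>; their leaf counts agree, both being the arity in \<open>p\<close>. The
  blocks of \<open>f\<close> partition the vertices of \<open>q\<close>, so the expansions glue to
  one family on \<open>q\<close>, which defines \<open>h\<close>.\<close>

lemma factor_if_emb:
  assumes f: "is_nmor p q f" and g: "is_nmor p r g"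
    and emb: "\<forall>l\<in>{1..nverts p}. emb (children (family f l)) (children (family g l))"
  shows "\<exists>h. is_nmor q r h \<and> g = ncomp h f"
proof -
  note f' = is_nmorD[OF f] and g' = is_nmorD[OF g]
  have "\<exists>H. family_ok (family f l) H \<and> subst (family f l) H = family g l" if l: "l \<in> {1..nverts p}" for l
  proof -
    obtain x cs where fl: "family f l = Node x cs"
      using nleaves_family(2)[OF f l] by (cases "family f l") auto
    obtain y ds where gl: "family g l = Node y ds"
      using nleaves_family(2)[OF g l] by (cases "family g l") auto
    have "emb cs ds" using bspec[OF emb l] unfolding fl gl children.simps .
    moreover have "sum_list (map nleaves cs) = sum_list (map nleaves ds)"
      using nleaves_family(1)[OF f l] nleaves_family(1)[OF g l] unfolding fl gl nleaves.simps by simp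
    moreover have "distinct (x # concat (map labels cs))"
      using distinct_labels_family[OF f l] unfolding fl labels.simps .
    ultimately show ?thesis unfolding fl gl by (rule emb_imp_subst)
  qed
  then obtain H where H: "\<And>l. l \<in> {1..nverts p} \<Longrightarrow> family_ok (family f l) (H l)"
    "\<And>l. l \<in> {1..nverts p} \<Longrightarrow> subst (family f l) (H l) = family g l" by metis
  define G where "G v = H (block f v) v" for v
  have G: "G v = H l v" if l: "l \<in> {1..nverts p}" and v: "v \<in> set (labels (family f l))" for l v
  proof -
    have "v \<in> {1..nverts q}" using set_labels_family_subset[OF f l] v by blast
    from block_eq_iff[OF f this l] show ?thesis using v by (simp add: G_def)
  qed
  have ok: "family_ok (family f l) G" if l: "l \<in> {1..nverts p}" for l
    using family_ok_cong[of "family f l" G "H l"] G[OF l] H(1)[OF l] by blast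
  have sub: "subst (family f l) G = family g l" if l: "l \<in> {1..nverts p}" for l
    using subst_cong[of "family f l" G "H l", OF G[OF l]] H(2)[OF l] by simp
  have ok': "\<forall>l\<in>set (labels p). family_ok (family f l) G"
    using ok set_labels_is_ptree[OF f'(1)] by simp
  have okq: "family_ok q G" using family_ok_subst_iff[OF f'(5), of G] ok' f'(6) by simp
  have "subst q G = subst p (\<lambda>l. subst (family f l) G)"
    using subst_subst[OF f'(5) ok'] f'(6) by simp
  also have "\<dots> = r"
    unfolding g'(6)[symmetric] using sub set_labels_is_ptree[OF f'(1)] by (intro subst_cong) simp
  finally have subq: "subst q G = r" .
  let ?h = "nmor_of q r G"
  have h: "is_nmor q r ?h" by (rule nmor_of(1)[OF f'(2) g'(2) okq subq])
  have "g = ncomp ?h f"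
  proof (rule nmor_eqI[OF g is_nmor_ncomp[OF f h]])
    fix l assume l: "l \<in> {1..nverts p}"
    have "family (ncomp ?h f) l = subst (family f l) (family ?h)"
      by (rule family_ncomp[OF f h l])
    also have "\<dots> = subst (family f l) G"
    proof (rule subst_cong)
      fix v assume "v \<in> set (labels (family f l))"
      then have "v \<in> {1..nverts q}" using set_labels_family_subset[OF f l] by blast
      then show "family ?h v = G v" by (rule nmor_of(2)[OF f'(2) g'(2) okq subq])
    qed
    finally show "family g l = family (ncomp ?h f) l" using sub[OF l] by simp
  qed
  with h show ?thesis by blast
qed

text \<open>Kruskal's theorem is applied simultaneously at the finitely many vertices of
  \<open>p\<close>; a pair good at all of them factors.\<close>

lemma noetherian_under_nupOp_op: "noetherian_under nupOp_op p"
  unfolding noetherian_under_def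
proof (intro allI impI)
  fix x :: "nat \<Rightarrow> nmor" assume "\<forall>i. x i \<in> out_mor nupOp_op p"
  then have x: "\<exists>q. is_nmor p q (x i)" for i by (auto simp: out_mor_def nupOp_op_def)
  have "good_on (\<lambda>f g. emb (children (family f l)) (children (family g l))) UNIV" for l
    using good_on_emb unfolding good_on_def by simp
  then have "good_on (\<lambda>f g. \<forall>l\<in>{1..nverts p}. emb (children (family f l)) (children (family g l))) UNIV"
    by (intro good_on_ball) auto
  then obtain i j :: nat where ij: "i < j"
      "\<forall>l\<in>{1..nverts p}. emb (children (family (x i) l)) (children (family (x j) l))"
    by (rule good_onD[of _ _ x]) auto
  obtain q r where q: "is_nmor p q (x i)" and r: "is_nmor p r (x j)" using x by metis
  obtain h where "is_nmor q r h" "x j = ncomp h (x i)" using factor_if_emb[OF q r ij(2)] by blast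
  then have "factor_le nupOp_op p (x i) (x j)"
    using q r is_nmorD(2)[OF q] is_nmorD(2)[OF r] by (auto simp: factor_le_def nupOp_op_def)
  with ij(1) show "\<exists>i j. i < j \<and> factor_le nupOp_op p (x i) (x j)" by blast
qed

theorem groebner_nupOp_op: "groebner nupOp_op"
  using is_category_nupOp_op admissible_order_nupOp_op noetherian_under_nupOp_op
  by (simp add: groebner_def)

section \<open>Coding trees and morphisms in the natural numbers\<close>

instance ptree :: countable
  by countable_datatype

theorem theorem3p8:
  shows "quasi_groebner nupOp_op"
proof (rule quasi_groebner_if_groebner[OF groebner_nupOp_op])
  show "inj (to_nat :: ptree \<Rightarrow> nat)" by simp
  show "inj (\<lambda>m :: nmor. to_nat (msrc m, mtrees m, mshuf m, mtgt m))" by (rule injI) (auto intro: nmor.equality)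
qed

end
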